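(* Let $G$ be a connected Lie group of real dimension $4$ equipped with a left invariant Riemannian metric $g$ and a left invariant (integrable) complex structure $J$ compatible with $g$. Assume that for some real number $s\neq 0,2$ the $s$-Gauduchon connection $\nabla^s$ of the Hermitian manifold $(G,J,g)$ is flat. Then $g$ is K\"ahler.
   Context: On a Hermitian manifold $(M,J,g)$, a Hermitian connection is an affine connection $\nabla$ with $\nabla J=0$ and $\nabla g=0$; the torsion is $T(x,y)=\nabla_xy-\nabla_yx-[x,y]$. The Chern connection $\nabla^c$ is the unique Hermitian connection whose torsion has no $(1,1)$-component, i.e. $T(x,\overline{y})=0$ for $x,y$ of type $(1,0)$. The Bismut connection $\nabla^b$ is the unique Hermitian connection whose torsion is totally skew-symmetric, i.e. $g(T(x,y),z)$ is a $3$-form. For $s\in\mathbb{R}$ the $s$-Gauduchon connection is $\nabla^s=(1-\frac{s}{2})\nabla^c+\frac{s}{2}\nabla^b$. Flat means that the curvature tensor vanishes identically. Compatible means $g(Jx,Jy)=g(x,y)$. $g$ is K\"ahler if the $2$-form $\omega(x,y)=g(Jx,y)$ is closed (equivalently, the Chern torsion vanishes). *)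

theory Defs
  imports "HOL-Analysis.Analysis" "HOL-Library.Function_Algebras"
begin

section \<open>Smooth maps between open subsets of Euclidean spaces\<close>

primrec Ck_on :: "nat \<Rightarrow> 'e::real_normed_vector set \<Rightarrow> ('e \<Rightarrow> 'f::real_normed_vector) \<Rightarrow> bool" where
  "Ck_on 0 S f \<longleftrightarrow> continuous_on S f"
| "Ck_on (Suc k) S f \<longleftrightarrow>
     f differentiable_on S \<and> (\<forall>v. Ck_on k S (\<lambda>x. frechet_derivative f (at x) v))"

text \<open>Only used for open sets \<open>S\<close> in Euclidean spaces, where this is the usual notion.\<close>

definition smooth_on :: "'e::real_normed_vector set \<Rightarrow> ('e \<Rightarrow> 'f::real_normed_vector) \<Rightarrow> bool" where
  "smooth_on S f \<longleftrightarrow> (\<forall>k. Ck_on k S f)"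


section \<open>Smooth manifolds\<close>

text \<open>A chart is a pair of its domain and its coordinate map; the coordinate map is irrelevant
  outside the domain. The manifold is the whole type \<open>'a\<close>. In \<open>smooth_atlas\<close> the Hausdorff
  and second countability conditions are sort constraints.\<close>

type_synonym ('a, 'e) chart = "'a set \<times> ('a \<Rightarrow> 'e)"

definition smooth_atlas ::
    "('a::{t2_space, second_countable_topology}, 'e::euclidean_space) chart set \<Rightarrow> bool" where
  "smooth_atlas A \<longleftrightarrow>
     (\<Union>(U, \<phi>)\<in>A. U) = UNIV \<and>
     (\<forall>(U, \<phi>)\<in>A. open U \<and> open (\<phi> ` U) \<and>
        homeomorphism U (\<phi> ` U) \<phi> (inv_into U \<phi>)) \<and>
     (\<forall>(U, \<phi>)\<in>A. \<forall>(V, \<psi>)\<in>A. smooth_on (\<phi> ` (U \<inter> V)) (\<psi> \<circ> inv_into U \<phi>))"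

definition smooth_fun_on ::
    "('a::topological_space, 'e::euclidean_space) chart set \<Rightarrow> 'a set \<Rightarrow> ('a \<Rightarrow> real) \<Rightarrow> bool" where
  "smooth_fun_on A W f \<longleftrightarrow>
     open W \<and> (\<forall>(U, \<phi>)\<in>A. smooth_on (\<phi> ` (U \<inter> W)) (f \<circ> inv_into U \<phi>))"

definition smooth_fun_near ::
    "('a::topological_space, 'e::euclidean_space) chart set \<Rightarrow> 'a \<Rightarrow> ('a \<Rightarrow> real) \<Rightarrow> bool" where
  "smooth_fun_near A p f \<longleftrightarrow> (\<exists>W. p \<in> W \<and> smooth_fun_on A W f)"

definition smooth_curve ::
    "('a::topological_space, 'e::euclidean_space) chart set \<Rightarrow> (real \<Rightarrow> 'a) \<Rightarrow> bool" where
  "smooth_curve A c \<longleftrightarrow>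
     (\<exists>\<epsilon>>0. continuous_on {-\<epsilon><..<\<epsilon>} c \<and>
        (\<forall>(U, \<phi>)\<in>A. smooth_on {t \<in> {-\<epsilon><..<\<epsilon>}. c t \<in> U} (\<phi> \<circ> c)))"


section \<open>Tangent vectors and vector fields\<close>

text \<open>A tangent vector at \<open>p\<close> is the velocity at time \<open>0\<close> of a smooth curve through \<open>p\<close>, regarded
  as an operator on the functions that are smooth near \<open>p\<close>. On all other functions it is \<open>0\<close> by
  convention, so that equality of tangent vectors is equality of operators.
  The additive structure (\<open>+\<close>, \<open>-\<close>, \<open>0\<close>) on tangent vectors and on vector fields is pointwise.\<close>

type_synonym 'a tangent = "('a \<Rightarrow> real) \<Rightarrow> real"
type_synonym 'a field = "'a \<Rightarrow> 'a tangent"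

definition velocity ::
    "('a::topological_space, 'e::euclidean_space) chart set \<Rightarrow> (real \<Rightarrow> 'a) \<Rightarrow> 'a tangent" where
  "velocity A c = (\<lambda>f. if smooth_fun_near A (c 0) f then deriv (f \<circ> c) 0 else 0)"

definition tangent_space ::
    "('a::topological_space, 'e::euclidean_space) chart set \<Rightarrow> 'a \<Rightarrow> 'a tangent set" where
  "tangent_space A p = {velocity A c | c. smooth_curve A c \<and> c 0 = p}"

definition tscale :: "real \<Rightarrow> 'a tangent \<Rightarrow> 'a tangent" where
  "tscale r v = (\<lambda>f. r * v f)"

definition fscale :: "('a \<Rightarrow> real) \<Rightarrow> 'a field \<Rightarrow> 'a field" where
  "fscale h X = (\<lambda>p. tscale (h p) (X p))"

definition dir_deriv :: "'a field \<Rightarrow> ('a \<Rightarrow> real) \<Rightarrow> 'a \<Rightarrow> real" where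
  "dir_deriv X f = (\<lambda>p. X p f)"

definition vector_field ::
    "('a::topological_space, 'e::euclidean_space) chart set \<Rightarrow> 'a field \<Rightarrow> bool" where
  "vector_field A X \<longleftrightarrow>
     (\<forall>p. X p \<in> tangent_space A p) \<and>
     (\<forall>W f. smooth_fun_on A W f \<longrightarrow> smooth_fun_on A W (dir_deriv X f))"

definition lie_bracket ::
    "('a::topological_space, 'e::euclidean_space) chart set \<Rightarrow> 'a field \<Rightarrow> 'a field \<Rightarrow> 'a field" where
  "lie_bracket A X Y = (\<lambda>p f.
     if smooth_fun_near A p f then X p (dir_deriv Y f) - Y p (dir_deriv X f) else 0)"


section \<open>Lie groups\<close>

text \<open>The group is written additively, but \<open>topological_group_add\<close> does not include commutativity.
  Smoothness of the multiplication is expressed in the charts \<open>\<phi> \<times> \<psi>\<close> of the product manifold.\<close>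

definition lie_group ::
    "('a::{topological_group_add, t2_space, second_countable_topology}, 'e::euclidean_space) chart set
      \<Rightarrow> bool" where
  "lie_group A \<longleftrightarrow>
     smooth_atlas A \<and>
     (\<forall>(U, \<phi>)\<in>A. \<forall>(V, \<psi>)\<in>A. \<forall>(W, \<theta>)\<in>A.
        smooth_on (map_prod \<phi> \<psi> ` {(x, y). x \<in> U \<and> y \<in> V \<and> x + y \<in> W})
          (\<lambda>(a, b). \<theta> (inv_into U \<phi> a + inv_into V \<psi> b))) \<and>
     (\<forall>(U, \<phi>)\<in>A. \<forall>(W, \<theta>)\<in>A.
        smooth_on (\<phi> ` {x \<in> U. - x \<in> W}) (\<lambda>a. \<theta> (- inv_into U \<phi> a)))"

text \<open>The differential of the left translation \<open>x \<mapsto> a + x\<close>.\<close>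

definition push_left :: "'a::plus \<Rightarrow> 'a tangent \<Rightarrow> 'a tangent" where
  "push_left a v = (\<lambda>f. v (\<lambda>x. f (a + x)))"


section \<open>Metrics and complex structures\<close>

type_synonym 'a metric = "'a \<Rightarrow> 'a tangent \<Rightarrow> 'a tangent \<Rightarrow> real"
type_synonym 'a endo = "'a \<Rightarrow> 'a tangent \<Rightarrow> 'a tangent"

definition app_metric :: "'a metric \<Rightarrow> 'a field \<Rightarrow> 'a field \<Rightarrow> 'a \<Rightarrow> real" where
  "app_metric g X Y = (\<lambda>p. g p (X p) (Y p))"

definition app_endo :: "'a endo \<Rightarrow> 'a field \<Rightarrow> 'a field" where
  "app_endo J X = (\<lambda>p. J p (X p))"

definition riemannian_metric ::
    "('a::topological_space, 'e::euclidean_space) chart set \<Rightarrow> 'a metric \<Rightarrow> bool" where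
  "riemannian_metric A g \<longleftrightarrow>
     (\<forall>p. \<forall>u\<in>tangent_space A p. \<forall>v\<in>tangent_space A p.
        g p u v = g p v u \<and>
        (\<forall>w\<in>tangent_space A p. g p (u + v) w = g p u w + g p v w) \<and>
        (\<forall>r. g p (tscale r u) v = r * g p u v) \<and>
        (u \<noteq> 0 \<longrightarrow> g p u u > 0)) \<and>
     (\<forall>X Y. vector_field A X \<longrightarrow> vector_field A Y \<longrightarrow> smooth_fun_on A UNIV (app_metric g X Y))"

definition almost_complex_structure ::
    "('a::topological_space, 'e::euclidean_space) chart set \<Rightarrow> 'a endo \<Rightarrow> bool" where
  "almost_complex_structure A J \<longleftrightarrow>
     (\<forall>p. \<forall>u\<in>tangent_space A p.
        J p u \<in> tangent_space A p \<and>
        (\<forall>v\<in>tangent_space A p. J p (u + v) = J p u + J p v) \<and>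
        (\<forall>r. J p (tscale r u) = tscale r (J p u)) \<and>
        J p (J p u) = - u) \<and>
     (\<forall>X. vector_field A X \<longrightarrow> vector_field A (app_endo J X))"

definition nijenhuis ::
    "('a::topological_space, 'e::euclidean_space) chart set \<Rightarrow> 'a endo \<Rightarrow> 'a field \<Rightarrow> 'a field \<Rightarrow> 'a field" where
  "nijenhuis A J X Y =
     lie_bracket A X Y + app_endo J (lie_bracket A (app_endo J X) Y)
     + app_endo J (lie_bracket A X (app_endo J Y)) - lie_bracket A (app_endo J X) (app_endo J Y)"

text \<open>Integrability is the vanishing of the Nijenhuis tensor; by the Newlander--Nirenberg theorem
  this is the existence of holomorphic charts.\<close>

definition complex_structure ::
    "('a::topological_space, 'e::euclidean_space) chart set \<Rightarrow> 'a endo \<Rightarrow> bool" where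
  "complex_structure A J \<longleftrightarrow>
     almost_complex_structure A J \<and>
     (\<forall>X Y. vector_field A X \<longrightarrow> vector_field A Y \<longrightarrow> nijenhuis A J X Y = 0)"

definition compatible ::
    "('a::topological_space, 'e::euclidean_space) chart set \<Rightarrow> 'a metric \<Rightarrow> 'a endo \<Rightarrow> bool" where
  "compatible A g J \<longleftrightarrow>
     (\<forall>p. \<forall>u\<in>tangent_space A p. \<forall>v\<in>tangent_space A p. g p (J p u) (J p v) = g p u v)"

definition left_invariant_metric ::
    "('a::{topological_space, plus}, 'e::euclidean_space) chart set \<Rightarrow> 'a metric \<Rightarrow> bool" where
  "left_invariant_metric A g \<longleftrightarrow>
     (\<forall>a p. \<forall>u\<in>tangent_space A p. \<forall>v\<in>tangent_space A p.
        g (a + p) (push_left a u) (push_left a v) = g p u v)"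

definition left_invariant_endo ::
    "('a::{topological_space, plus}, 'e::euclidean_space) chart set \<Rightarrow> 'a endo \<Rightarrow> bool" where
  "left_invariant_endo A J \<longleftrightarrow>
     (\<forall>a p. \<forall>u\<in>tangent_space A p. J (a + p) (push_left a u) = push_left a (J p u))"


section \<open>Connections\<close>

type_synonym 'a connection = "'a field \<Rightarrow> 'a field \<Rightarrow> 'a field"

text \<open>A connection is only constrained on (smooth) vector fields; \<open>D X Y\<close> is the covariant derivative
  of \<open>Y\<close> in the direction \<open>X\<close>.\<close>

definition affine_connection ::
    "('a::topological_space, 'e::euclidean_space) chart set \<Rightarrow> 'a connection \<Rightarrow> bool" where
  "affine_connection A D \<longleftrightarrow>
     (\<forall>X Y. vector_field A X \<longrightarrow> vector_field A Y \<longrightarrow>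
        vector_field A (D X Y) \<and>
        (\<forall>Z. vector_field A Z \<longrightarrow>
           D (X + Y) Z = D X Z + D Y Z \<and> D Z (X + Y) = D Z X + D Z Y) \<and>
        (\<forall>h. smooth_fun_on A UNIV h \<longrightarrow>
           D (fscale h X) Y = fscale h (D X Y) \<and>
           D X (fscale h Y) = fscale (dir_deriv X h) Y + fscale h (D X Y)))"

definition torsion ::
    "('a::topological_space, 'e::euclidean_space) chart set \<Rightarrow> 'a connection \<Rightarrow> 'a field \<Rightarrow> 'a field \<Rightarrow> 'a field" where
  "torsion A D X Y = D X Y - D Y X - lie_bracket A X Y"

definition curvature ::
    "('a::topological_space, 'e::euclidean_space) chart set \<Rightarrow> 'a connection
      \<Rightarrow> 'a field \<Rightarrow> 'a field \<Rightarrow> 'a field \<Rightarrow> 'a field" where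
  "curvature A D X Y Z = D X (D Y Z) - D Y (D X Z) - D (lie_bracket A X Y) Z"

definition flat_connection ::
    "('a::topological_space, 'e::euclidean_space) chart set \<Rightarrow> 'a connection \<Rightarrow> bool" where
  "flat_connection A D \<longleftrightarrow>
     (\<forall>X Y Z. vector_field A X \<longrightarrow> vector_field A Y \<longrightarrow> vector_field A Z \<longrightarrow> curvature A D X Y Z = 0)"

definition hermitian_connection ::
    "('a::topological_space, 'e::euclidean_space) chart set \<Rightarrow> 'a metric \<Rightarrow> 'a endo \<Rightarrow> 'a connection \<Rightarrow> bool" where
  "hermitian_connection A g J D \<longleftrightarrow>
     affine_connection A D \<and>
     (\<forall>X Y. vector_field A X \<longrightarrow> vector_field A Y \<longrightarrow> D X (app_endo J Y) = app_endo J (D X Y)) \<and>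
     (\<forall>X Y Z. vector_field A X \<longrightarrow> vector_field A Y \<longrightarrow> vector_field A Z \<longrightarrow>
        dir_deriv X (app_metric g Y Z) = app_metric g (D X Y) Z + app_metric g Y (D X Z))"

text \<open>A complex vector field \<open>X + \<i> Y\<close> is represented by the pair \<open>(X, Y)\<close>.
  It has type \<open>(1,0)\<close> iff \<open>J (X + \<i> Y) = \<i> (X + \<i> Y)\<close>.\<close>

definition type_10 ::
    "('a::topological_space, 'e::euclidean_space) chart set \<Rightarrow> 'a endo \<Rightarrow> 'a field \<times> 'a field \<Rightarrow> bool" where
  "type_10 A J Z \<longleftrightarrow>
     (case Z of (X, Y) \<Rightarrow> vector_field A X \<and> vector_field A Y \<and>
        (app_endo J X, app_endo J Y) = (- Y, X))"

definition conj_field :: "'a field \<times> 'a field \<Rightarrow> 'a field \<times> 'a field" where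
  "conj_field Z = (case Z of (X, Y) \<Rightarrow> (X, - Y))"

definition torsion_complex ::
    "('a::topological_space, 'e::euclidean_space) chart set \<Rightarrow> 'a connection
      \<Rightarrow> 'a field \<times> 'a field \<Rightarrow> 'a field \<times> 'a field \<Rightarrow> 'a field \<times> 'a field" where
  "torsion_complex A D Z W = (case Z of (X, Y) \<Rightarrow> case W of (X', Y') \<Rightarrow>
     (torsion A D X X' - torsion A D Y Y', torsion A D X Y' + torsion A D Y X'))"

definition chern_connection ::
    "('a::topological_space, 'e::euclidean_space) chart set \<Rightarrow> 'a metric \<Rightarrow> 'a endo \<Rightarrow> 'a connection \<Rightarrow> bool" where
  "chern_connection A g J D \<longleftrightarrow>
     hermitian_connection A g J D \<and>
     (\<forall>Z W. type_10 A J Z \<longrightarrow> type_10 A J W \<longrightarrow> torsion_complex A D Z (conj_field W) = (0, 0))"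

text \<open>The torsion is a tensor and skew in its first two arguments anyway, so being a \<open>3\<close>-form means
  total skew-symmetry.\<close>

definition bismut_connection ::
    "('a::topological_space, 'e::euclidean_space) chart set \<Rightarrow> 'a metric \<Rightarrow> 'a endo \<Rightarrow> 'a connection \<Rightarrow> bool" where
  "bismut_connection A g J D \<longleftrightarrow>
     hermitian_connection A g J D \<and>
     (\<forall>X Y Z. vector_field A X \<longrightarrow> vector_field A Y \<longrightarrow> vector_field A Z \<longrightarrow>
        app_metric g (torsion A D X Y) Z = - app_metric g (torsion A D Y X) Z \<and>
        app_metric g (torsion A D X Y) Z = - app_metric g (torsion A D X Z) Y)"

definition gauduchon :: "real \<Rightarrow> 'a connection \<Rightarrow> 'a connection \<Rightarrow> 'a connection" where
  "gauduchon s Dc Db = (\<lambda>X Y. fscale (\<lambda>p. 1 - s / 2) (Dc X Y) + fscale (\<lambda>p. s / 2) (Db X Y))"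


section \<open>The Kaehler condition\<close>

text \<open>Smooth \<open>2\<close>-forms have the same type as metrics. The exterior derivative is given by its
  coordinate-free formula.\<close>

definition fundamental_form :: "'a metric \<Rightarrow> 'a endo \<Rightarrow> 'a metric" where
  "fundamental_form g J = (\<lambda>p u v. g p (J p u) v)"

definition ext_deriv2 ::
    "('a::topological_space, 'e::euclidean_space) chart set \<Rightarrow> 'a metric
      \<Rightarrow> 'a field \<Rightarrow> 'a field \<Rightarrow> 'a field \<Rightarrow> 'a \<Rightarrow> real" where
  "ext_deriv2 A \<omega> X Y Z =
     dir_deriv X (app_metric \<omega> Y Z) - dir_deriv Y (app_metric \<omega> X Z) + dir_deriv Z (app_metric \<omega> X Y)
     - app_metric \<omega> (lie_bracket A X Y) Z + app_metric \<omega> (lie_bracket A X Z) Y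
     - app_metric \<omega> (lie_bracket A Y Z) X"

definition kaehler ::
    "('a::topological_space, 'e::euclidean_space) chart set \<Rightarrow> 'a metric \<Rightarrow> 'a endo \<Rightarrow> bool" where
  "kaehler A g J \<longleftrightarrow>
     (\<forall>X Y Z. vector_field A X \<longrightarrow> vector_field A Y \<longrightarrow> vector_field A Z \<longrightarrow>
        ext_deriv2 A (fundamental_form g J) X Y Z = 0)"

end

(*
  In a left invariant unitary frame the Chern and Bismut connections have constant coefficients, so
  everything happens on the Lie algebra, identified with C^2. In complex dimension 2 the Chern torsion
  is det(x, y) w for a vector w, and the torsion of the s-Gauduchon connection D is an explicit function
  of w and s. Flatness of D and the Jacobi identity give the first Bianchi identity, which expresses the
  derivative of w quadratically in w. Suppose w is not 0 and take w = (a, 0), e = (0, 1). With D x the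
  skew-Hermitian matrix of the coefficients and d(x) the imaginary part of its last entry, the identity
  says for s different from 0 and 1 that D e and D (i e) are diagonal and d(i e) = -2 (1 - s/2) a; for
  s = 1 it is contradictory. The last entry of [D e, D (i e)] = D [e, i e] then reads
  0 = - d(e)^2 - d(i e)^2, so s = 2.
*)

theory Submission
  imports Defs
begin

section \<open>Calculus of smooth maps\<close>

text \<open>The definitions of the Chern and Bismut connections do not mention left invariance, so
  the constancy of their coefficients has to be proved. At \<open>p\<close> and at \<open>0\<close>
  these coefficients solve the same linear equations, whose data are the structure constants, and
  the homogeneous equations have only the zero solution.

  Complex dimension 2 enters twice. An alternating complex bilinear map on C^2 is a multiple of
  \<open>cdet\<close>, whence the vector \<open>w\<close>. And
  \<open>herm z (csig x) = cdet x z\<close>, so that Bismut minus Chern in direction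
  \<open>x\<close> is the adjoint of \<open>y \<mapsto> cdet x y w\<close> minus that map itself. As
  D preserves \<open>herm\<close> and changes \<open>cdet\<close> by a trace, the derivative of the
  torsion in direction \<open>x\<close> is again a \<open>tors\<close>, for the vector
  \<open>D x w\<close> minus \<open>tr (D x)\<close> times \<open>w\<close>; hence Bianchi is linear
  in D and quadratic in \<open>w\<close>.

  The vectors \<open>e\<close> and \<open>i e\<close> are singled out because the torsion of any
  such pair orthogonal to \<open>w\<close> vanishes: their bracket comes from D alone.\<close>

lemma has_derivative_frechet:
  "f differentiable at x \<Longrightarrow> (f has_derivative frechet_derivative f (at x)) (at x)"
  by (simp add: frechet_derivative_works)

lemma frechet_derivative_eqI: "(f has_derivative f') (at x) \<Longrightarrow> frechet_derivative f (at x) = f'"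
  by (metis frechet_derivative_at)

text \<open>\<open>Ck_on\<close> takes derivatives in the ambient space. For an open
  \<open>S\<close> they see only the values on \<open>S\<close>.\<close>

lemma Ck_on_cong:
  assumes "open S" "\<And>x. x \<in> S \<Longrightarrow> f x = g x" "Ck_on k S f"
  shows "Ck_on k S g"
  using assms(2,3)
proof (induction k arbitrary: f g)
  case 0
  then show ?case by (simp cong: continuous_on_cong)
next
  case (Suc k)
  have d: "f differentiable at x" if "x \<in> S" for x
    using Suc.prems that assms(1) by (simp add: differentiable_on_eq_differentiable_at)
  have eq: "frechet_derivative f (at x) = frechet_derivative g (at x)" if "x \<in> S" for x
    by (rule frechet_derivative_transform_within_open[OF d[OF that] assms(1) that Suc.prems(1)])
  have "g differentiable at x" if "x \<in> S" for x
    using has_derivative_transform_within_open[OF has_derivative_frechet[OF d[OF that]] assms(1) that Suc.prems(1)]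
    by (auto simp: differentiable_def)
  moreover have "Ck_on k S (\<lambda>x. frechet_derivative g (at x) v)" for v
    by (rule Suc.IH[of "\<lambda>x. frechet_derivative f (at x) v"]) (use Suc.prems eq in auto)
  ultimately show ?case using assms(1) by (simp add: differentiable_on_eq_differentiable_at)
qed

lemma Ck_on_subset: "Ck_on k S f \<Longrightarrow> T \<subseteq> S \<Longrightarrow> Ck_on k T f"
  by (induction k arbitrary: f) (auto intro: continuous_on_subset differentiable_on_subset)

lemma Ck_on_SucD: "Ck_on (Suc k) S f \<Longrightarrow> Ck_on k S f"
proof (induction k arbitrary: f)
  case 0
  then show ?case by (auto intro: differentiable_imp_continuous_on)
next
  case (Suc k)
  then show ?case by (metis Ck_on.simps(2))
qed

lemma Ck_on_local:
  assumes "\<And>x. x \<in> S \<Longrightarrow> \<exists>T. open T \<and> x \<in> T \<and> Ck_on k T f"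
  shows "Ck_on k S f"
  using assms
proof (induction k arbitrary: f)
  case 0
  show ?case unfolding Ck_on.simps continuous_on_eq_continuous_within
  proof
    fix x assume "x \<in> S"
    then obtain T where "open T" "x \<in> T" "continuous_on T f" using 0[of x] by auto
    then have "continuous (at x) f" by (simp add: continuous_on_eq_continuous_at)
    then show "continuous (at x within S) f" by (rule continuous_at_imp_continuous_at_within)
  qed
next
  case (Suc k)
  have "f differentiable at x within S" if x: "x \<in> S" for x
  proof -
    obtain T where "open T" "x \<in> T" "f differentiable_on T" using Suc.prems[OF x] by auto
    then have "f differentiable at x" by (simp add: differentiable_on_eq_differentiable_at)
    then show ?thesis by (rule differentiable_at_withinI)
  qed
  moreover have "Ck_on k S (\<lambda>x. frechet_derivative f (at x) v)" for v
    by (rule Suc.IH) (use Suc.prems in force)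
  ultimately show ?case by (simp add: differentiable_on_def)
qed

lemma Ck_on_const: "Ck_on k S (\<lambda>x. c)"
  by (induction k arbitrary: c) (auto simp: frechet_derivative_const)

lemma Ck_on_bounded_linear:
  assumes "bounded_linear L" "open S" "Ck_on k S f"
  shows "Ck_on k S (\<lambda>x. L (f x))"
  using assms(3)
proof (induction k arbitrary: f)
  case 0
  then show ?case using assms(1) by (simp add: bounded_linear.continuous_on)
next
  case (Suc k)
  have d: "((\<lambda>x. L (f x)) has_derivative (\<lambda>v. L (frechet_derivative f (at x) v))) (at x)" if "x \<in> S" for x
    using Suc.prems that assms(2)
    by (intro bounded_linear.has_derivative[OF assms(1)] has_derivative_frechet)
      (simp add: differentiable_on_eq_differentiable_at)
  have "Ck_on k S (\<lambda>x. frechet_derivative (\<lambda>x. L (f x)) (at x) v)" for v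
    by (rule Ck_on_cong[OF assms(2), of "\<lambda>x. L (frechet_derivative f (at x) v)"])
      (use frechet_derivative_eqI[OF d] Suc in auto)
  then show ?case using d assms(2) by (auto simp: differentiable_on_eq_differentiable_at differentiable_def)
qed

lemma Ck_on_add:
  assumes "open S" "Ck_on k S f" "Ck_on k S g"
  shows "Ck_on k S (\<lambda>x. f x + g x)"
  using assms(2,3)
proof (induction k arbitrary: f g)
  case 0
  then show ?case by (simp add: continuous_on_add)
next
  case (Suc k)
  have d: "((\<lambda>x. f x + g x) has_derivative
      (\<lambda>v. frechet_derivative f (at x) v + frechet_derivative g (at x) v)) (at x)" if "x \<in> S" for x
    using Suc.prems that assms(1)
    by (intro has_derivative_add has_derivative_frechet) (simp_all add: differentiable_on_eq_differentiable_at)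
  have "Ck_on k S (\<lambda>x. frechet_derivative (\<lambda>x. f x + g x) (at x) v)" for v
    by (rule Ck_on_cong[OF assms(1), of "\<lambda>x. frechet_derivative f (at x) v + frechet_derivative g (at x) v"])
      (use frechet_derivative_eqI[OF d] Suc in auto)
  then show ?case using d assms(1) by (auto simp: differentiable_on_eq_differentiable_at differentiable_def)
qed

lemma Ck_on_sum:
  assumes "open S" "finite I" "\<And>i. i \<in> I \<Longrightarrow> Ck_on k S (f i)"
  shows "Ck_on k S (\<lambda>x. \<Sum>i\<in>I. f i x)"
  using assms(2,3) by (induction I) (auto simp: Ck_on_const intro: Ck_on_add[OF assms(1)])

lemma Ck_on_bounded_bilinear:
  assumes "bounded_bilinear B" "open S" "Ck_on k S f" "Ck_on k S g"
  shows "Ck_on k S (\<lambda>x. B (f x) (g x))"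
  using assms(3,4)
proof (induction k arbitrary: f g)
  case 0
  then show ?case using assms(1) by (simp add: bounded_bilinear.continuous_on)
next
  case (Suc k)
  let ?d = "\<lambda>x v. B (f x) (frechet_derivative g (at x) v) + B (frechet_derivative f (at x) v) (g x)"
  have d: "((\<lambda>x. B (f x) (g x)) has_derivative ?d x) (at x)" if "x \<in> S" for x
    using Suc.prems that assms(2)
    by (intro bounded_bilinear.FDERIV[OF assms(1)] has_derivative_frechet)
      (simp_all add: differentiable_on_eq_differentiable_at)
  have "Ck_on k S f" "Ck_on k S g" using Suc.prems Ck_on_SucD by blast+
  then have "Ck_on k S (\<lambda>x. ?d x v)" for v
    using Suc.prems by (intro Ck_on_add[OF assms(2)] Suc.IH) auto
  then have "Ck_on k S (\<lambda>x. frechet_derivative (\<lambda>x. B (f x) (g x)) (at x) v)" for v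
    by (rule Ck_on_cong[OF assms(2), rotated]) (simp add: frechet_derivative_eqI[OF d])
  then show ?case using d assms(2) by (auto simp: differentiable_on_eq_differentiable_at differentiable_def)
qed

lemma frechet_derivative_expand_Basis:
  fixes f :: "'e::euclidean_space \<Rightarrow> 'f::real_normed_vector"
  assumes "f differentiable at y"
  shows "frechet_derivative f (at y) w = (\<Sum>b\<in>Basis. (w \<bullet> b) *\<^sub>R frechet_derivative f (at y) b)"
proof -
  have l: "linear (frechet_derivative f (at y))" by (rule linear_frechet_derivative[OF assms])
  have "frechet_derivative f (at y) (\<Sum>b\<in>Basis. (w \<bullet> b) *\<^sub>R b) = (\<Sum>b\<in>Basis. (w \<bullet> b) *\<^sub>R frechet_derivative f (at y) b)"
    by (simp add: linear_sum[OF l] linear_cmul[OF l])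
  then show ?thesis by (simp add: euclidean_representation)
qed

text \<open>The chain rule differentiates \<open>f\<close> in the direction
  \<open>frechet_derivative g (at x) v\<close>, which moves with \<open>x\<close>, whereas
  \<open>Ck_on\<close> controls fixed directions only. Expanding that direction in
  \<open>Basis\<close> reduces the claim to products and to composites of lower order.\<close>

lemma Ck_on_compose:
  fixes f :: "'e::euclidean_space \<Rightarrow> 'f::real_normed_vector" and g :: "'d::real_normed_vector \<Rightarrow> 'e"
  assumes "open S" "open T" "g ` S \<subseteq> T" "Ck_on k T f" "Ck_on k S g"
  shows "Ck_on k S (\<lambda>x. f (g x))"
  using assms(4,5)
proof (induction k arbitrary: f)
  case 0
  then show ?case using assms(3) by (auto intro: continuous_on_compose2)
next
  case (Suc k)
  let ?d = "\<lambda>x v. \<Sum>b\<in>Basis. (frechet_derivative g (at x) v \<bullet> b) *\<^sub>R frechet_derivative f (at (g x)) b"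
  have df: "f differentiable at (g x)" and dg: "g differentiable at x" if "x \<in> S" for x
    using Suc.prems that assms(1-3) by (auto simp: differentiable_on_eq_differentiable_at)
  have d: "((\<lambda>x. f (g x)) has_derivative ?d x) (at x)" if "x \<in> S" for x
    using has_derivative_compose[OF has_derivative_frechet[OF dg[OF that]] has_derivative_frechet[OF df[OF that]]]
    unfolding frechet_derivative_expand_Basis[OF df[OF that], of "frechet_derivative g (at x) _"] .
  have "Ck_on k S (\<lambda>x. ?d x v)" for v
  proof (intro Ck_on_sum[OF assms(1)] Ck_on_bounded_bilinear[OF bounded_bilinear_scaleR assms(1)])
    fix b :: 'e assume "b \<in> Basis"
    show "Ck_on k S (\<lambda>x. frechet_derivative g (at x) v \<bullet> b)"
      by (rule Ck_on_bounded_linear[OF bounded_linear_inner_left assms(1)]) (use Suc.prems in simp)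
    show "Ck_on k S (\<lambda>x. frechet_derivative f (at (g x)) b)"
      by (rule Suc.IH) (use Suc.prems Ck_on_SucD in auto)
  qed simp
  then have "Ck_on k S (\<lambda>x. frechet_derivative (\<lambda>x. f (g x)) (at x) v)" for v
    by (rule Ck_on_cong[OF assms(1), rotated]) (simp add: frechet_derivative_eqI[OF d])
  then show ?case using d assms(1) by (auto simp: differentiable_on_eq_differentiable_at differentiable_def)
qed

lemma smooth_on_cong: "open S \<Longrightarrow> smooth_on S f \<Longrightarrow> (\<And>x. x \<in> S \<Longrightarrow> f x = g x) \<Longrightarrow> smooth_on S g"
  unfolding smooth_on_def using Ck_on_cong by blast

lemma smooth_on_subset: "smooth_on S f \<Longrightarrow> T \<subseteq> S \<Longrightarrow> smooth_on T f"
  unfolding smooth_on_def using Ck_on_subset by blast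

lemma smooth_on_local:
  "(\<And>x. x \<in> S \<Longrightarrow> \<exists>T. open T \<and> x \<in> T \<and> smooth_on T f) \<Longrightarrow> smooth_on S f"
  unfolding smooth_on_def using Ck_on_local by metis

lemma smooth_on_differentiable: "open S \<Longrightarrow> smooth_on S f \<Longrightarrow> x \<in> S \<Longrightarrow> f differentiable at x"
  unfolding smooth_on_def using Ck_on.simps(2) differentiable_on_eq_differentiable_at by blast

lemma smooth_on_frechet_derivative: "smooth_on S f \<Longrightarrow> smooth_on S (\<lambda>x. frechet_derivative f (at x) v)"
  unfolding smooth_on_def using Ck_on.simps(2) by blast

lemma smooth_on_continuous: "smooth_on S f \<Longrightarrow> continuous_on S f"
  unfolding smooth_on_def using Ck_on.simps(1) by blast

lemma smooth_on_const [simp]: "smooth_on S (\<lambda>x. c)"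
  by (simp add: smooth_on_def Ck_on_const)

lemma smooth_on_ident [simp]: "smooth_on S (\<lambda>x. x)"
proof -
  have "Ck_on k S (\<lambda>x::'a. x)" for k
    by (cases k) (auto simp: Ck_on_const frechet_derivative_ident)
  then show ?thesis by (simp add: smooth_on_def)
qed

lemma smooth_on_bounded_linear: "bounded_linear L \<Longrightarrow> open S \<Longrightarrow> smooth_on S f \<Longrightarrow> smooth_on S (\<lambda>x. L (f x))"
  unfolding smooth_on_def using Ck_on_bounded_linear by blast

lemma smooth_on_add: "open S \<Longrightarrow> smooth_on S f \<Longrightarrow> smooth_on S g \<Longrightarrow> smooth_on S (\<lambda>x. f x + g x)"
  unfolding smooth_on_def using Ck_on_add by blast

lemma smooth_on_scaleR:
  "open S \<Longrightarrow> smooth_on S f \<Longrightarrow> smooth_on S g \<Longrightarrow> smooth_on S (\<lambda>x. f x *\<^sub>R g x)"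
  unfolding smooth_on_def using Ck_on_bounded_bilinear[OF bounded_bilinear_scaleR] by blast

lemma smooth_on_mult:
  fixes f g :: "'e::real_normed_vector \<Rightarrow> real"
  shows "open S \<Longrightarrow> smooth_on S f \<Longrightarrow> smooth_on S g \<Longrightarrow> smooth_on S (\<lambda>x. f x * g x)"
  using smooth_on_scaleR[of S f g] by simp

lemma smooth_on_sum:
  "open S \<Longrightarrow> finite I \<Longrightarrow> (\<And>i. i \<in> I \<Longrightarrow> smooth_on S (f i)) \<Longrightarrow> smooth_on S (\<lambda>x. \<Sum>i\<in>I. f i x)"
  unfolding smooth_on_def using Ck_on_sum by blast

lemma smooth_on_Pair:
  assumes "open S" "smooth_on S f" "smooth_on S g"
  shows "smooth_on S (\<lambda>x. (f x, g x))"
proof -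
  have "bounded_linear (\<lambda>x. (x, 0))" "bounded_linear (\<lambda>x. (0, x))"
    by (intro bounded_linear_Pair bounded_linear_ident bounded_linear_zero)+
  from this[THEN smooth_on_bounded_linear, OF assms(1)] assms
  have "smooth_on S (\<lambda>x. (f x, 0) + (0, g x))" by (intro smooth_on_add)
  then show ?thesis by simp
qed

lemma smooth_on_compose:
  fixes f :: "'e::euclidean_space \<Rightarrow> 'f::real_normed_vector" and g :: "'d::real_normed_vector \<Rightarrow> 'e"
  shows "open S \<Longrightarrow> open T \<Longrightarrow> smooth_on T f \<Longrightarrow> smooth_on S g \<Longrightarrow> g ` S \<subseteq> T \<Longrightarrow> smooth_on S (\<lambda>x. f (g x))"
  unfolding smooth_on_def using Ck_on_compose by blast

section \<open>Symmetry of second derivatives\<close>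

lemma DERIV_along_line:
  fixes f :: "'e::real_normed_vector \<Rightarrow> real"
  assumes "f differentiable at (a + t *\<^sub>R u)"
  shows "((\<lambda>t. f (a + t *\<^sub>R u)) has_real_derivative frechet_derivative f (at (a + t *\<^sub>R u)) u) (at t)"
proof -
  have l: "linear (frechet_derivative f (at (a + t *\<^sub>R u)))" by (rule linear_frechet_derivative[OF assms])
  have "((\<lambda>t. a + t *\<^sub>R u) has_derivative (\<lambda>t. t *\<^sub>R u)) (at t)"
    by (auto intro!: derivative_eq_intros)
  from has_derivative_compose[OF this has_derivative_frechet[OF assms]]
  show ?thesis
    by (simp add: has_field_derivative_def linear_cmul[OF l] mult.commute[of _ "frechet_derivative _ _ _"])
qed

text \<open>Two uses of the mean value theorem, first along \<open>u\<close> and then along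
  \<open>v\<close>. The left side is symmetric in \<open>u\<close> and \<open>v\<close>, the right
  side is not visibly so; this is what forces mixed derivatives to agree.\<close>

lemma second_difference_mean_value:
  fixes f :: "'e::real_normed_vector \<Rightarrow> real"
  assumes f: "\<And>y. dist x y < r \<Longrightarrow> f differentiable at y"
    and df: "\<And>y. dist x y < r \<Longrightarrow> (\<lambda>z. frechet_derivative f (at z) u) differentiable at y"
    and h: "0 < h" "h * (norm u + norm v) < r"
  shows "\<exists>p. dist x p < r \<and> f (x + h *\<^sub>R u + h *\<^sub>R v) - f (x + h *\<^sub>R u) - f (x + h *\<^sub>R v) + f x
    = h * (h * frechet_derivative (\<lambda>z. frechet_derivative f (at z) u) (at p) v)"
proof -
  have close: "dist x (x + t *\<^sub>R u + \<tau> *\<^sub>R v) < r" if "0 \<le> t" "t \<le> h" "0 \<le> \<tau>" "\<tau> \<le> h" for t \<tau>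
  proof -
    have "dist x (x + t *\<^sub>R u + \<tau> *\<^sub>R v) = norm (t *\<^sub>R u + \<tau> *\<^sub>R v)"
      by (metis add.assoc add_diff_cancel_left' dist_norm norm_minus_commute)
    also have "\<dots> \<le> t * norm u + \<tau> * norm v" using norm_triangle_ineq[of "t *\<^sub>R u" "\<tau> *\<^sub>R v"] that by simp
    also have "\<dots> \<le> h * norm u + h * norm v" using that by (intro add_mono mult_right_mono) auto
    finally show ?thesis using h by (simp add: algebra_simps)
  qed
  let ?d = "\<lambda>y. frechet_derivative f (at y) u"
  have "\<exists>t>0. t < h \<and> (f (x + h *\<^sub>R v + h *\<^sub>R u) - f (x + h *\<^sub>R u)) - (f (x + h *\<^sub>R v + 0 *\<^sub>R u) - f (x + 0 *\<^sub>R u))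
     = (h - 0) * (?d (x + h *\<^sub>R v + t *\<^sub>R u) - ?d (x + t *\<^sub>R u))"
  proof (rule MVT2[OF h(1)])
    fix t assume t: "0 \<le> t" "t \<le> h"
    have "dist x (x + h *\<^sub>R v + t *\<^sub>R u) < r" "dist x (x + t *\<^sub>R u) < r"
      using close[of t h] close[of t 0] t h by (simp_all add: add_ac)
    then show "((\<lambda>t. f (x + h *\<^sub>R v + t *\<^sub>R u) - f (x + t *\<^sub>R u)) has_real_derivative
        ?d (x + h *\<^sub>R v + t *\<^sub>R u) - ?d (x + t *\<^sub>R u)) (at t)"
      by (intro DERIV_diff DERIV_along_line f)
  qed
  then obtain t where t: "0 < t" "t < h"
    "(f (x + h *\<^sub>R v + h *\<^sub>R u) - f (x + h *\<^sub>R u)) - (f (x + h *\<^sub>R v) - f x)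
     = h * (?d (x + h *\<^sub>R v + t *\<^sub>R u) - ?d (x + t *\<^sub>R u))" by auto
  have "\<exists>\<tau>>0. \<tau> < h \<and> ?d (x + t *\<^sub>R u + h *\<^sub>R v) - ?d (x + t *\<^sub>R u + 0 *\<^sub>R v)
     = (h - 0) * frechet_derivative ?d (at (x + t *\<^sub>R u + \<tau> *\<^sub>R v)) v"
  proof (rule MVT2[OF h(1)])
    fix \<tau> assume "0 \<le> \<tau>" "\<tau> \<le> h"
    then have "dist x (x + t *\<^sub>R u + \<tau> *\<^sub>R v) < r" using close t by simp
    then show "((\<lambda>\<tau>. ?d (x + t *\<^sub>R u + \<tau> *\<^sub>R v)) has_real_derivative
        frechet_derivative ?d (at (x + t *\<^sub>R u + \<tau> *\<^sub>R v)) v) (at \<tau>)"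
      by (intro DERIV_along_line df)
  qed
  then obtain \<tau> where \<tau>: "0 < \<tau>" "\<tau> < h" "?d (x + t *\<^sub>R u + h *\<^sub>R v) - ?d (x + t *\<^sub>R u)
     = h * frechet_derivative ?d (at (x + t *\<^sub>R u + \<tau> *\<^sub>R v)) v" by auto
  show ?thesis
    using close[of t \<tau>] t \<tau> by (intro exI[of _ "x + t *\<^sub>R u + \<tau> *\<^sub>R v"]) (simp add: add_ac algebra_simps)
qed

text \<open>The second difference computed in both orders makes the two mixed derivatives equal at
  points \<open>p\<close> and \<open>q\<close> arbitrarily close to \<open>x\<close>; continuity
  moves the equality to \<open>x\<close>.\<close>

lemma frechet_derivative_commute:
  fixes f :: "'e::real_normed_vector \<Rightarrow> real"
  assumes "open S" "x \<in> S" "smooth_on S f"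
  shows "frechet_derivative (\<lambda>y. frechet_derivative f (at y) u) (at x) v
    = frechet_derivative (\<lambda>y. frechet_derivative f (at y) v) (at x) u"
proof -
  let ?d = "\<lambda>u v x. frechet_derivative (\<lambda>y. frechet_derivative f (at y) u) (at x) v"
  have cont: "isCont (?d a b) x" for a b
    using smooth_on_continuous[OF smooth_on_frechet_derivative[OF smooth_on_frechet_derivative[OF assms(3)]]] assms(1,2)
    by (simp add: continuous_on_eq_continuous_at)
  show ?thesis
  proof (rule ccontr)
    assume ne: "?d u v x \<noteq> ?d v u x"
    \<comment> \<open>Half the gap: two numbers within \<open>e\<close> of the two values cannot
      coincide.\<close>
    define e where "e = \<bar>?d u v x - ?d v u x\<bar> / 2"
    have e: "e > 0" using ne by (simp add: e_def)
    obtain r1 where r1: "r1 > 0" "\<And>y. dist y x < r1 \<Longrightarrow> dist (?d u v y) (?d u v x) < e"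
      using cont[of u v] e unfolding continuous_at_eps_delta by blast
    obtain r2 where r2: "r2 > 0" "\<And>y. dist y x < r2 \<Longrightarrow> dist (?d v u y) (?d v u x) < e"
      using cont[of v u] e unfolding continuous_at_eps_delta by blast
    obtain r3 where r3: "r3 > 0" "\<And>y. dist x y < r3 \<Longrightarrow> y \<in> S"
      using assms(1,2) unfolding open_contains_ball by (metis mem_ball subsetD)
    define r where "r = min r1 (min r2 r3)"
    \<comment> \<open>The added 1 keeps the denominator positive when \<open>u\<close> and
      \<open>v\<close> are both 0 and makes the bound by \<open>r\<close> strict.\<close>
    define h where "h = r / (norm u + norm v + 1)"
    have r: "r > 0" using r1 r2 r3 by (simp add: r_def)
    have N: "norm u + norm v + 1 > 0" by (simp add: add_nonneg_pos)
    have h: "h > 0" using r N by (simp add: h_def)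
    have "h * (norm u + norm v) < h * (norm u + norm v + 1)" using h by simp
    also have "\<dots> = r" using N by (simp add: h_def)
    finally have hr: "h * (norm u + norm v) < r" "h * (norm v + norm u) < r" by (simp_all add: add.commute)
    have S: "y \<in> S" if "dist x y < r" for y using that r3 by (simp add: r_def)
    have D: "f differentiable at y" "(\<lambda>z. frechet_derivative f (at z) w) differentiable at y" if "dist x y < r" for y w
      using S[OF that] assms(1,3) smooth_on_differentiable smooth_on_frechet_derivative by blast+
    obtain p where p: "dist x p < r"
      "f (x + h *\<^sub>R u + h *\<^sub>R v) - f (x + h *\<^sub>R u) - f (x + h *\<^sub>R v) + f x = h * (h * ?d u v p)"
      using second_difference_mean_value[OF D(1) D(2) h hr(1)] by blast
    obtain q where q: "dist x q < r"
      "f (x + h *\<^sub>R v + h *\<^sub>R u) - f (x + h *\<^sub>R v) - f (x + h *\<^sub>R u) + f x = h * (h * ?d v u q)"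
      using second_difference_mean_value[OF D(1) D(2) h hr(2)] by blast
    have "h * (h * ?d u v p) = h * (h * ?d v u q)" using p(2) q(2) by (simp add: add_ac algebra_simps)
    then have eq: "?d u v p = ?d v u q" using h by simp
    have "dist (?d u v p) (?d u v x) < e" "dist (?d v u q) (?d v u x) < e"
      using r1(2)[of p] r2(2)[of q] p(1) q(1) by (simp_all add: r_def dist_commute)
    then show False using eq unfolding e_def dist_real_def by (auto simp: abs_if split: if_splits)
  qed
qed

text \<open>The product rule for a moving direction, with the two directions of the second
  derivative exchanged. In this form the second order terms of a commutator of fields
  cancel.\<close>

lemma frechet_derivative_along_field:
  fixes f :: "'e::euclidean_space \<Rightarrow> real"
  assumes S: "open S" "x \<in> S" and f: "smooth_on S f" and b: "smooth_on S b"
  shows "frechet_derivative (\<lambda>y. frechet_derivative f (at y) (b y)) (at x) v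
    = frechet_derivative f (at x) (frechet_derivative b (at x) v)
      + frechet_derivative (\<lambda>y. frechet_derivative f (at y) v) (at x) (b x)"
proof -
  let ?d = "\<lambda>i y. frechet_derivative f (at y) i"
  let ?D = "\<lambda>v. \<Sum>i\<in>Basis. (b x \<bullet> i) * frechet_derivative (?d i) (at x) v
    + (frechet_derivative b (at x) v \<bullet> i) * ?d i x"
  have df: "f differentiable at y" if "y \<in> S" for y using smooth_on_differentiable[OF S(1) f that] .
  have dd: "?d i differentiable at x" for i
    by (rule smooth_on_differentiable[OF S(1) smooth_on_frechet_derivative[OF f] S(2)])
  have db: "b differentiable at x" by (rule smooth_on_differentiable[OF S(1) b S(2)])
  have "((\<lambda>y. \<Sum>i\<in>Basis. (b y \<bullet> i) * ?d i y) has_derivative ?D) (at x)"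
    by (intro has_derivative_sum has_derivative_mult has_derivative_inner_left has_derivative_frechet dd db)
  then have "((\<lambda>y. frechet_derivative f (at y) (b y)) has_derivative ?D) (at x)"
    by (rule has_derivative_transform_within_open[OF _ S]) (simp add: frechet_derivative_expand_Basis[OF df, of _ "b _"])
  then have "frechet_derivative (\<lambda>y. frechet_derivative f (at y) (b y)) (at x) v = ?D v"
    by (simp add: frechet_derivative_eqI)
  also have "\<dots> = (\<Sum>i\<in>Basis. (b x \<bullet> i) * frechet_derivative (?d v) (at x) i)
      + (\<Sum>i\<in>Basis. (frechet_derivative b (at x) v \<bullet> i) * ?d i x)"
    unfolding sum.distrib using frechet_derivative_commute[OF S f, of _ v] by (metis (no_types, lifting))
  also have "\<dots> = frechet_derivative (?d v) (at x) (b x) + frechet_derivative f (at x) (frechet_derivative b (at x) v)"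
    using frechet_derivative_expand_Basis[OF df[OF S(2)], of "frechet_derivative b (at x) v"]
      frechet_derivative_expand_Basis[OF dd[of v], of "b x"] by simp
  finally show ?thesis by simp
qed

lemma smooth_on_componentwise:
  fixes f :: "'d::real_normed_vector \<Rightarrow> 'e::euclidean_space"
  assumes "open S" "\<And>b. b \<in> Basis \<Longrightarrow> smooth_on S (\<lambda>x. f x \<bullet> b)"
  shows "smooth_on S f"
proof -
  have "smooth_on S (\<lambda>x. \<Sum>b\<in>Basis. (f x \<bullet> b) *\<^sub>R b)"
    by (intro smooth_on_sum smooth_on_scaleR assms) auto
  then show ?thesis by (simp add: euclidean_representation)
qed

section \<open>Tangent spaces and the Lie bracket\<close>

locale smooth_manifold =
  fixes A :: "('a::{t2_space, second_countable_topology}, 'e::euclidean_space) chart set"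
  assumes atlas: "smooth_atlas A"
begin

section \<open>Charts, smooth functions and tangent vectors\<close>

lemma chart_ex: "\<exists>U \<phi>. (U, \<phi>) \<in> A \<and> p \<in> U"
proof -
  have "(\<Union>(U, \<phi>)\<in>A. U) = UNIV" using atlas unfolding smooth_atlas_def by (elim conjE)
  then have "p \<in> (\<Union>(U, \<phi>)\<in>A. U)" by simp
  then show ?thesis by auto
qed

lemma chart:
  assumes "(U, \<phi>) \<in> A"
  shows "open U" "open (\<phi> ` U)" "homeomorphism U (\<phi> ` U) \<phi> (inv_into U \<phi>)"
proof -
  have "\<forall>(U, \<phi>)\<in>A. open U \<and> open (\<phi> ` U) \<and> homeomorphism U (\<phi> ` U) \<phi> (inv_into U \<phi>)"
    using atlas unfolding smooth_atlas_def by (elim conjE)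
  from bspec[OF this assms] show "open U" "open (\<phi> ` U)" "homeomorphism U (\<phi> ` U) \<phi> (inv_into U \<phi>)"
    by simp_all
qed

lemma chart_continuous:
  assumes "(U, \<phi>) \<in> A"
  shows "continuous_on U \<phi>" "continuous_on (\<phi> ` U) (inv_into U \<phi>)"
  using homeomorphism_cont1[OF chart(3)[OF assms]] homeomorphism_cont2[OF chart(3)[OF assms]] by auto

lemma chart_inv [simp]: "(U, \<phi>) \<in> A \<Longrightarrow> x \<in> U \<Longrightarrow> inv_into U \<phi> (\<phi> x) = x"
  using homeomorphism_apply1[OF chart(3)] by blast

lemma chart_image_eq:
  assumes "(U, \<phi>) \<in> A"
  shows "\<phi> ` (U \<inter> W) = {y \<in> \<phi> ` U. inv_into U \<phi> y \<in> W}"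
  using assms by auto

lemma chart_open_image:
  assumes "(U, \<phi>) \<in> A" "open W"
  shows "open (\<phi> ` (U \<inter> W))"
proof -
  have "open (\<phi> ` U \<inter> inv_into U \<phi> -` W)"
    by (rule continuous_open_preimage[OF chart_continuous(2) chart(2)]) (use assms in auto)
  moreover have "\<phi> ` U \<inter> inv_into U \<phi> -` W = \<phi> ` (U \<inter> W)" using assms by auto
  ultimately show ?thesis by simp
qed

lemma chart_transition:
  "(U, \<phi>) \<in> A \<Longrightarrow> (V, \<psi>) \<in> A \<Longrightarrow> smooth_on (\<phi> ` (U \<inter> V)) (\<psi> \<circ> inv_into U \<phi>)"
  using atlas unfolding smooth_atlas_def by (elim conjE) (drule (1) bspec, simp, drule (1) bspec, simp)

lemma smooth_fun_on_open: "smooth_fun_on A W f \<Longrightarrow> open W"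
  by (simp add: smooth_fun_on_def)

lemma smooth_fun_on_chart:
  "smooth_fun_on A W f \<Longrightarrow> (U, \<phi>) \<in> A \<Longrightarrow> smooth_on (\<phi> ` (U \<inter> W)) (\<lambda>y. f (inv_into U \<phi> y))"
  unfolding smooth_fun_on_def comp_def by (drule conjunct2, drule (1) bspec) simp

lemma smooth_fun_onI:
  "open W \<Longrightarrow> (\<And>U \<phi>. (U, \<phi>) \<in> A \<Longrightarrow> smooth_on (\<phi> ` (U \<inter> W)) (\<lambda>y. f (inv_into U \<phi> y))) \<Longrightarrow> smooth_fun_on A W f"
  unfolding smooth_fun_on_def comp_def by auto

lemma smooth_fun_on_subset: "smooth_fun_on A W f \<Longrightarrow> open W' \<Longrightarrow> W' \<subseteq> W \<Longrightarrow> smooth_fun_on A W' f"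
  by (rule smooth_fun_onI) (auto intro: smooth_on_subset[OF smooth_fun_on_chart])

lemma smooth_fun_on_cong:
  assumes "smooth_fun_on A W f" "\<And>x. x \<in> W \<Longrightarrow> f x = g x"
  shows "smooth_fun_on A W g"
proof (rule smooth_fun_onI)
  show W: "open W" by (rule smooth_fun_on_open[OF assms(1)])
  fix U \<phi> assume U: "(U, \<phi>) \<in> A"
  show "smooth_on (\<phi> ` (U \<inter> W)) (\<lambda>y. g (inv_into U \<phi> y))"
    by (rule smooth_on_cong[OF chart_open_image[OF U W] smooth_fun_on_chart[OF assms(1) U]])
      (use assms(2) U in auto)
qed

lemma smooth_fun_on_const [simp]: "open W \<Longrightarrow> smooth_fun_on A W (\<lambda>x. c)"
  by (rule smooth_fun_onI) auto

lemma smooth_fun_on_add: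
  "smooth_fun_on A W f \<Longrightarrow> smooth_fun_on A W g \<Longrightarrow> smooth_fun_on A W (\<lambda>x. f x + g x)"
  by (rule smooth_fun_onI, erule smooth_fun_on_open, rule smooth_on_add,
    erule (1) chart_open_image[OF _ smooth_fun_on_open], erule (1) smooth_fun_on_chart, erule (1) smooth_fun_on_chart)

lemma smooth_fun_on_mult:
  "smooth_fun_on A W f \<Longrightarrow> smooth_fun_on A W g \<Longrightarrow> smooth_fun_on A W (\<lambda>x. f x * g x)"
  by (rule smooth_fun_onI, erule smooth_fun_on_open, rule smooth_on_mult,
    erule (1) chart_open_image[OF _ smooth_fun_on_open], erule (1) smooth_fun_on_chart, erule (1) smooth_fun_on_chart)

lemma smooth_fun_on_diff:
  "smooth_fun_on A W f \<Longrightarrow> smooth_fun_on A W g \<Longrightarrow> smooth_fun_on A W (\<lambda>x. f x - g x)"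
  using smooth_fun_on_add[of W f "\<lambda>x. (-1) * g x"] smooth_fun_on_mult[of W "\<lambda>x. -1" g]
  by (simp add: smooth_fun_on_open)

lemma smooth_fun_on_coordinate:
  assumes "(U, \<phi>) \<in> A"
  shows "smooth_fun_on A U (\<lambda>x. \<phi> x \<bullet> b)"
proof (rule smooth_fun_onI[OF chart(1)[OF assms]])
  fix V \<psi> assume V: "(V, \<psi>) \<in> A"
  show "smooth_on (\<psi> ` (V \<inter> U)) (\<lambda>y. \<phi> (inv_into V \<psi> y) \<bullet> b)"
    using smooth_on_bounded_linear[OF bounded_linear_inner_left chart_open_image[OF V chart(1)[OF assms]]
      chart_transition[OF V assms]] by (simp add: comp_def)
qed

lemma smooth_fun_nearI: "smooth_fun_on A W f \<Longrightarrow> p \<in> W \<Longrightarrow> smooth_fun_near A p f"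
  unfolding smooth_fun_near_def by blast

lemma smooth_fun_near2:
  assumes "smooth_fun_near A p f" "smooth_fun_near A p g"
  obtains W where "p \<in> W" "smooth_fun_on A W f" "smooth_fun_on A W g"
proof -
  obtain W W' where W: "p \<in> W" "smooth_fun_on A W f" "p \<in> W'" "smooth_fun_on A W' g"
    using assms unfolding smooth_fun_near_def by blast
  show thesis
    by (rule that[of "W \<inter> W'"]) (use W in \<open>auto intro: smooth_fun_on_subset smooth_fun_on_open\<close>)
qed

lemma smooth_fun_near_cong:
  assumes "smooth_fun_near A p f" "open W" "p \<in> W" "\<And>x. x \<in> W \<Longrightarrow> f x = g x"
  shows "smooth_fun_near A p g"
proof -
  obtain W' where W': "p \<in> W'" "smooth_fun_on A W' f" using assms(1) unfolding smooth_fun_near_def by blast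
  have "smooth_fun_on A (W \<inter> W') f"
    using W' assms(2) by (auto intro: smooth_fun_on_subset smooth_fun_on_open)
  then have "smooth_fun_on A (W \<inter> W') g" by (rule smooth_fun_on_cong) (use assms(4) in auto)
  then show ?thesis using assms W' by (auto intro: smooth_fun_nearI)
qed

lemma smooth_fun_near_differentiable:
  assumes "smooth_fun_near A p f" "(U, \<phi>) \<in> A" "p \<in> U"
  shows "(\<lambda>y. f (inv_into U \<phi> y)) differentiable at (\<phi> p)"
proof -
  obtain W where W: "p \<in> W" "smooth_fun_on A W f" using assms(1) unfolding smooth_fun_near_def by blast
  show ?thesis
    by (rule smooth_on_differentiable[OF chart_open_image[OF assms(2) smooth_fun_on_open[OF W(2)]]
        smooth_fun_on_chart[OF W(2) assms(2)]]) (use assms W in auto)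
qed

text \<open>The tangent vector with coordinate vector \<open>w\<close> in the chart. The default
  value 0 is the one in \<open>velocity\<close>, so that both can be equal as operators on all
  functions.\<close>

definition tvec :: "'a set \<Rightarrow> ('a \<Rightarrow> 'e) \<Rightarrow> 'a \<Rightarrow> 'e \<Rightarrow> 'a tangent" where
  "tvec U \<phi> p w = (\<lambda>f. if smooth_fun_near A p f
     then frechet_derivative (\<lambda>y. f (inv_into U \<phi> y)) (at (\<phi> p)) w else 0)"

lemma curve_open_preimage:
  fixes c :: "real \<Rightarrow> 'a"
  assumes "continuous_on I c" "open I" "open W"
  shows "open {t \<in> I. c t \<in> W}"
proof -
  have "{t \<in> I. c t \<in> W} = I \<inter> c -` W" by auto
  then show ?thesis using continuous_open_preimage[OF assms] by simp
qed

text \<open>The curve may leave any given chart, so smoothness is checked near each time separately,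
  in a chart around \<open>c t\<close>.\<close>

lemma smooth_fun_along_curve:
  fixes c :: "real \<Rightarrow> 'a"
  assumes c: "continuous_on I c" "open I" and s: "\<forall>(U, \<phi>)\<in>A. smooth_on {t \<in> I. c t \<in> U} (\<phi> \<circ> c)"
    and h: "smooth_fun_on A W h"
  shows "smooth_on {t \<in> I. c t \<in> W} (\<lambda>t. h (c t))"
proof (rule smooth_on_local)
  fix t assume t: "t \<in> {t \<in> I. c t \<in> W}"
  obtain U \<phi> where U: "(U, \<phi>) \<in> A" "c t \<in> U" using chart_ex by blast
  let ?S = "{t \<in> I. c t \<in> U \<inter> W}"
  have W: "open W" by (rule smooth_fun_on_open[OF h])
  have S: "open ?S" by (rule curve_open_preimage[OF c]) (use W chart(1)[OF U(1)] in auto)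
  have "smooth_on {t \<in> I. c t \<in> U} (\<lambda>t. \<phi> (c t))" using bspec[OF s U(1)] by (simp add: comp_def)
  then have "smooth_on ?S (\<lambda>t. \<phi> (c t))" by (rule smooth_on_subset) auto
  then have "smooth_on ?S (\<lambda>t. h (inv_into U \<phi> (\<phi> (c t))))"
    by (rule smooth_on_compose[OF S chart_open_image[OF U(1) W] smooth_fun_on_chart[OF h U(1)]]) auto
  then have "smooth_on ?S (\<lambda>t. h (c t))" by (rule smooth_on_cong[OF S]) (use U in auto)
  then show "\<exists>T. open T \<and> t \<in> T \<and> smooth_on T (\<lambda>t. h (c t))" using S t U by blast
qed

text \<open>Single coordinates are smooth real functions, so the last premise is in reach of
  \<open>smooth_fun_along_curve\<close>. This serves for translated curves.\<close>

lemma smooth_curveI: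
  assumes "\<epsilon> > 0" "continuous_on {-\<epsilon><..<\<epsilon>} c"
    and "\<And>U \<phi> b. (U, \<phi>) \<in> A \<Longrightarrow> b \<in> Basis \<Longrightarrow> smooth_on {t \<in> {-\<epsilon><..<\<epsilon>}. c t \<in> U} (\<lambda>t. \<phi> (c t) \<bullet> b)"
  shows "smooth_curve A c"
proof -
  have "smooth_on {t \<in> {-\<epsilon><..<\<epsilon>}. c t \<in> U} (\<phi> \<circ> c)" if U: "(U, \<phi>) \<in> A" for U \<phi>
  proof (rule smooth_on_componentwise)
    show "open {t \<in> {-\<epsilon><..<\<epsilon>}. c t \<in> U}"
      by (rule curve_open_preimage[OF assms(2) _ chart(1)[OF U]]) simp
  qed (use assms(3)[OF U] in simp)
  then show ?thesis unfolding smooth_curve_def using assms(1,2) by blast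
qed

lemma velocity_eq_tvec:
  assumes c: "smooth_curve A c" and U: "(U, \<phi>) \<in> A" "c 0 \<in> U"
  shows "velocity A c = tvec U \<phi> (c 0) (vector_derivative (\<lambda>t. \<phi> (c t)) (at 0))"
proof
  fix f
  obtain \<epsilon> where \<epsilon>: "\<epsilon> > 0" "continuous_on {-\<epsilon><..<\<epsilon>} c"
    "\<forall>(U, \<phi>)\<in>A. smooth_on {t \<in> {-\<epsilon><..<\<epsilon>}. c t \<in> U} (\<phi> \<circ> c)"
    using c unfolding smooth_curve_def by blast
  let ?S = "{t \<in> {-\<epsilon><..<\<epsilon>}. c t \<in> U}"
  let ?w = "vector_derivative (\<lambda>t. \<phi> (c t)) (at 0)"
  have S: "open ?S" "0 \<in> ?S"
    using curve_open_preimage[OF \<epsilon>(2) _ chart(1)[OF U(1)]] \<epsilon>(1) U by auto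
  have "smooth_on ?S (\<lambda>t. \<phi> (c t))" using bspec[OF \<epsilon>(3) U(1)] by (simp add: comp_def)
  then have "(\<lambda>t. \<phi> (c t)) differentiable at 0" using smooth_on_differentiable S by blast
  then have d: "((\<lambda>t. \<phi> (c t)) has_derivative (\<lambda>t. t *\<^sub>R ?w)) (at 0)"
    by (metis vector_derivative_works has_vector_derivative_def)
  show "velocity A c f = tvec U \<phi> (c 0) ?w f"
  proof (cases "smooth_fun_near A (c 0) f")
    case True
    let ?f = "\<lambda>y. f (inv_into U \<phi> y)"
    have df: "?f differentiable at (\<phi> (c 0))" by (rule smooth_fun_near_differentiable[OF True U])
    note l = linear_frechet_derivative[OF df]
    have "((\<lambda>t. ?f (\<phi> (c t))) has_derivative (\<lambda>t. frechet_derivative ?f (at (\<phi> (c 0))) (t *\<^sub>R ?w))) (at 0)"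
      by (rule has_derivative_compose[OF d has_derivative_frechet[OF df]])
    then have "((\<lambda>t. f (c t)) has_derivative (\<lambda>t. frechet_derivative ?f (at (\<phi> (c 0))) (t *\<^sub>R ?w))) (at 0)"
      by (rule has_derivative_transform_within_open[OF _ S]) (use U in auto)
    then have "((\<lambda>t. f (c t)) has_real_derivative frechet_derivative ?f (at (\<phi> (c 0))) ?w) (at 0)"
      by (simp add: has_field_derivative_def linear_cmul[OF l] mult.commute[of _ "frechet_derivative _ _ _"])
    then show ?thesis using True by (simp add: velocity_def tvec_def comp_def DERIV_imp_deriv)
  qed (simp add: velocity_def tvec_def)
qed

text \<open>The witness is the straight line through \<open>\<phi> p\<close> with direction
  \<open>w\<close>, pulled back by the chart for times so short that the line stays in the chart
  image.\<close>

lemma tvec_in_tangent_space: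
  assumes U: "(U, \<phi>) \<in> A" "p \<in> U"
  shows "tvec U \<phi> p w \<in> tangent_space A p"
proof -
  have "open ((\<lambda>t. \<phi> p + t *\<^sub>R w) -` (\<phi> ` U))"
    by (intro open_vimage chart(2)[OF U(1)] continuous_intros)
  moreover have "0 \<in> (\<lambda>t. \<phi> p + t *\<^sub>R w) -` (\<phi> ` U)" using U by auto
  ultimately obtain \<epsilon> where \<epsilon>: "\<epsilon> > 0" "ball 0 \<epsilon> \<subseteq> (\<lambda>t. \<phi> p + t *\<^sub>R w) -` (\<phi> ` U)"
    using open_contains_ball by blast
  have ball: "(ball 0 \<epsilon> :: real set) = {-\<epsilon><..<\<epsilon>}" by (simp add: ball_eq_greaterThanLessThan)
  have im: "\<phi> p + t *\<^sub>R w \<in> \<phi> ` U" if "t \<in> {-\<epsilon><..<\<epsilon>}" for t using \<epsilon>(2) that unfolding ball by auto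
  define c where "c t = inv_into U \<phi> (\<phi> p + t *\<^sub>R w)" for t
  have c0: "c 0 = p" using U by (simp add: c_def)
  have cont: "continuous_on {-\<epsilon><..<\<epsilon>} c" unfolding c_def
    by (rule continuous_on_compose2[OF chart_continuous(2)[OF U(1)]]) (use im in \<open>auto intro!: continuous_intros\<close>)
  have "smooth_on {t \<in> {-\<epsilon><..<\<epsilon>}. c t \<in> V} (\<lambda>t. \<psi> (c t))" if V: "(V, \<psi>) \<in> A" for V \<psi>
  proof -
    have op: "open {t \<in> {-\<epsilon><..<\<epsilon>}. c t \<in> V}" by (rule curve_open_preimage[OF cont _ chart(1)[OF V]]) simp
    have sm: "smooth_on {t \<in> {-\<epsilon><..<\<epsilon>}. c t \<in> V} (\<lambda>t. \<phi> p + t *\<^sub>R w)"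
      by (intro smooth_on_add smooth_on_scaleR op) auto
    have "(\<lambda>t. \<phi> p + t *\<^sub>R w) ` {t \<in> {-\<epsilon><..<\<epsilon>}. c t \<in> V} \<subseteq> \<phi> ` (U \<inter> V)"
      unfolding chart_image_eq[OF U(1)] using im by (auto simp: c_def)
    from smooth_on_compose[OF op chart_open_image[OF U(1) chart(1)[OF V]] chart_transition[OF U(1) V] sm this]
    show ?thesis by (simp add: c_def)
  qed
  then have sc: "smooth_curve A c" unfolding smooth_curve_def using \<epsilon>(1) cont by (auto simp: comp_def)
  have "((\<lambda>t. \<phi> p + t *\<^sub>R w) has_vector_derivative w) (at 0)"
    unfolding has_vector_derivative_def by (auto intro!: derivative_eq_intros)
  then have "((\<lambda>t. \<phi> (c t)) has_vector_derivative w) (at 0)"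
    by (rule has_vector_derivative_transform_within_open[of _ _ _ "{-\<epsilon><..<\<epsilon>}"])
      (use \<epsilon>(1) im in \<open>auto simp: c_def f_inv_into_f\<close>)
  then have "velocity A c = tvec U \<phi> p w"
    using velocity_eq_tvec[OF sc U(1)] c0 U by (simp add: vector_derivative_at)
  then show ?thesis unfolding tangent_space_def using sc c0 by (intro CollectI exI[of _ c]) simp
qed

text \<open>Curves cannot be added, but coordinate vectors can: this identification is what makes
  the set of velocities a vector space.\<close>

lemma tangent_space_eq:
  assumes U: "(U, \<phi>) \<in> A" "p \<in> U"
  shows "tangent_space A p = range (tvec U \<phi> p)"
  using tvec_in_tangent_space[OF U] velocity_eq_tvec[OF _ U(1)] U(2)
  by (auto simp: tangent_space_def)

lemma tangentE:
  assumes "v \<in> tangent_space A p"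
  obtains U \<phi> w where "(U, \<phi>) \<in> A" "p \<in> U" "v = tvec U \<phi> p w"
  using chart_ex[of p] tangent_space_eq assms by blast

lemma tvec_linear:
  assumes U: "(U, \<phi>) \<in> A" "p \<in> U"
  shows "tvec U \<phi> p (v + w) = tvec U \<phi> p v + tvec U \<phi> p w"
    and "tvec U \<phi> p (r *\<^sub>R v) = tscale r (tvec U \<phi> p v)"
  using linear_frechet_derivative[OF smooth_fun_near_differentiable[OF _ U]]
  by (auto simp: tvec_def tscale_def fun_eq_iff linear_add linear_cmul)

lemma tvec_coordinate:
  assumes U: "(U, \<phi>) \<in> A" "p \<in> U"
  shows "tvec U \<phi> p w (\<lambda>x. \<phi> x \<bullet> b) = w \<bullet> b"
proof -
  have "((\<lambda>y. y \<bullet> b) has_derivative (\<lambda>y. y \<bullet> b)) (at (\<phi> p))" by (auto intro!: derivative_eq_intros)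
  then have "((\<lambda>y. \<phi> (inv_into U \<phi> y) \<bullet> b) has_derivative (\<lambda>y. y \<bullet> b)) (at (\<phi> p))"
    by (rule has_derivative_transform_within_open[OF _ chart(2)[OF U(1)]]) (use U in \<open>auto simp: f_inv_into_f\<close>)
  then show ?thesis using smooth_fun_nearI[OF smooth_fun_on_coordinate[OF U(1)] U(2)]
    by (simp add: tvec_def frechet_derivative_eqI)
qed

lemma tvec_inject:
  assumes U: "(U, \<phi>) \<in> A" "p \<in> U"
  shows "tvec U \<phi> p v = tvec U \<phi> p w \<longleftrightarrow> v = w"
  using tvec_coordinate[OF U] by (metis euclidean_eq_iff)

lemma tangent_add [intro]:
  assumes "u \<in> tangent_space A p" "v \<in> tangent_space A p"
  shows "u + v \<in> tangent_space A p"
proof -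
  obtain U \<phi> where U: "(U, \<phi>) \<in> A" "p \<in> U" using chart_ex by blast
  then obtain w z where "u = tvec U \<phi> p w" "v = tvec U \<phi> p z"
    using assms tangent_space_eq[OF U] by auto
  then have "u + v = tvec U \<phi> p (w + z)" by (simp add: tvec_linear[OF U])
  then show ?thesis using tvec_in_tangent_space[OF U] by simp
qed

lemma tangent_scale [intro]:
  assumes "u \<in> tangent_space A p"
  shows "tscale r u \<in> tangent_space A p"
proof -
  obtain U \<phi> where U: "(U, \<phi>) \<in> A" "p \<in> U" using chart_ex by blast
  then obtain w where "u = tvec U \<phi> p w" using assms tangent_space_eq[OF U] by auto
  then have "tscale r u = tvec U \<phi> p (r *\<^sub>R w)" by (simp add: tvec_linear[OF U])
  then show ?thesis using tvec_in_tangent_space[OF U] by simp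
qed

lemma tscale_minus: "tscale (-1) v = - v"
  by (auto simp: tscale_def)

lemma tangent_minus [intro]: "u \<in> tangent_space A p \<Longrightarrow> - u \<in> tangent_space A p"
  using tangent_scale[of u p "-1"] by (simp add: tscale_minus)

lemma tangent_diff [intro]:
  "u \<in> tangent_space A p \<Longrightarrow> v \<in> tangent_space A p \<Longrightarrow> u - v \<in> tangent_space A p"
  using tangent_add[of u p "- v"] tangent_minus[of v p] by simp

lemma tangent_zero [intro]: "0 \<in> tangent_space A p"
proof -
  obtain U \<phi> where "(U, \<phi>) \<in> A" "p \<in> U" using chart_ex by blast
  then have "tvec U \<phi> p 0 \<in> tangent_space A p" by (rule tvec_in_tangent_space)
  from tangent_scale[OF this, of 0] show ?thesis by (simp add: tscale_def zero_fun_def)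
qed

lemma tangent_not_near: "v \<in> tangent_space A p \<Longrightarrow> \<not> smooth_fun_near A p f \<Longrightarrow> v f = 0"
  by (auto simp: tangent_space_def velocity_def)

lemma tangent_cong:
  assumes v: "v \<in> tangent_space A p" and f: "smooth_fun_near A p f"
    and W: "open W" "p \<in> W" "\<And>x. x \<in> W \<Longrightarrow> f x = g x"
  shows "v f = v g"
proof -
  obtain U \<phi> w where U: "(U, \<phi>) \<in> A" "p \<in> U" "v = tvec U \<phi> p w" using tangentE[OF v] .
  have "frechet_derivative (\<lambda>y. f (inv_into U \<phi> y)) (at (\<phi> p)) = frechet_derivative (\<lambda>y. g (inv_into U \<phi> y)) (at (\<phi> p))"
    by (rule frechet_derivative_transform_within_open[OF smooth_fun_near_differentiable[OF f U(1,2)]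
      chart_open_image[OF U(1) W(1)]]) (use U W in auto)
  then show ?thesis using f smooth_fun_near_cong[OF f W] by (simp add: U(3) tvec_def)
qed

lemma tangent_const: "v \<in> tangent_space A p \<Longrightarrow> v (\<lambda>x. c) = 0"
  by (elim tangentE) (simp add: tvec_def frechet_derivative_const)

lemma tangent_sum_fun:
  assumes v: "v \<in> tangent_space A p" and f: "smooth_fun_near A p f" "smooth_fun_near A p g"
  shows "v (\<lambda>x. f x + g x) = v f + v g"
proof -
  obtain U \<phi> w where U: "(U, \<phi>) \<in> A" "p \<in> U" "v = tvec U \<phi> p w" using tangentE[OF v] .
  obtain W where W: "p \<in> W" "smooth_fun_on A W f" "smooth_fun_on A W g" using smooth_fun_near2[OF f] .
  have "((\<lambda>y. f (inv_into U \<phi> y) + g (inv_into U \<phi> y)) has_derivative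
    (\<lambda>w. frechet_derivative (\<lambda>y. f (inv_into U \<phi> y)) (at (\<phi> p)) w
     + frechet_derivative (\<lambda>y. g (inv_into U \<phi> y)) (at (\<phi> p)) w)) (at (\<phi> p))"
    by (intro has_derivative_add has_derivative_frechet smooth_fun_near_differentiable f U)
  then show ?thesis using f smooth_fun_nearI[OF smooth_fun_on_add[OF W(2,3)] W(1)]
    by (simp add: U(3) tvec_def frechet_derivative_eqI)
qed

lemma tangent_mult_fun:
  assumes v: "v \<in> tangent_space A p" and f: "smooth_fun_near A p f" "smooth_fun_near A p g"
  shows "v (\<lambda>x. f x * g x) = f p * v g + v f * g p"
proof -
  obtain U \<phi> w where U: "(U, \<phi>) \<in> A" "p \<in> U" "v = tvec U \<phi> p w" using tangentE[OF v] .
  obtain W where W: "p \<in> W" "smooth_fun_on A W f" "smooth_fun_on A W g" using smooth_fun_near2[OF f] .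
  have "((\<lambda>y. f (inv_into U \<phi> y) * g (inv_into U \<phi> y)) has_derivative
    (\<lambda>w. f (inv_into U \<phi> (\<phi> p)) * frechet_derivative (\<lambda>y. g (inv_into U \<phi> y)) (at (\<phi> p)) w
     + frechet_derivative (\<lambda>y. f (inv_into U \<phi> y)) (at (\<phi> p)) w * g (inv_into U \<phi> (\<phi> p)))) (at (\<phi> p))"
    by (intro has_derivative_mult has_derivative_frechet smooth_fun_near_differentiable f U)
  then show ?thesis using f smooth_fun_nearI[OF smooth_fun_on_mult[OF W(2,3)] W(1)] U
    by (simp add: tvec_def frechet_derivative_eqI)
qed

lemma tangent_diff_fun:
  assumes v: "v \<in> tangent_space A p" and f: "smooth_fun_near A p f" "smooth_fun_near A p g"
  shows "v (\<lambda>x. f x - g x) = v f - v g"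
proof -
  obtain W where W: "p \<in> W" "smooth_fun_on A W f" "smooth_fun_on A W g" using smooth_fun_near2[OF f] .
  have "smooth_fun_near A p (\<lambda>x. f x - g x)" using W smooth_fun_on_diff smooth_fun_nearI by blast
  from tangent_sum_fun[OF v this f(2)] show ?thesis by simp
qed

section \<open>Vector fields and their brackets\<close>

lemma vector_field_tangent [intro]: "vector_field A X \<Longrightarrow> X p \<in> tangent_space A p"
  by (simp add: vector_field_def)

lemma vector_field_smooth [intro]:
  "vector_field A X \<Longrightarrow> smooth_fun_on A W f \<Longrightarrow> smooth_fun_on A W (dir_deriv X f)"
  by (simp add: vector_field_def)

lemma vector_field_near: "vector_field A X \<Longrightarrow> smooth_fun_near A p f \<Longrightarrow> smooth_fun_near A p (dir_deriv X f)"
  unfolding smooth_fun_near_def by blast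

lemma vector_field_add [intro]:
  assumes "vector_field A X" "vector_field A Y" shows "vector_field A (X + Y)"
  unfolding vector_field_def
proof (intro conjI allI impI)
  show "(X + Y) p \<in> tangent_space A p" for p using assms by auto
  show "smooth_fun_on A W (dir_deriv (X + Y) f)" if "smooth_fun_on A W f" for W f
    using smooth_fun_on_add[OF vector_field_smooth[OF assms(1) that] vector_field_smooth[OF assms(2) that]]
    by (simp add: dir_deriv_def)
qed

lemma vector_field_fscale [intro]:
  assumes "vector_field A X" "smooth_fun_on A UNIV h" shows "vector_field A (fscale h X)"
  unfolding vector_field_def
proof (intro conjI allI impI)
  show "fscale h X p \<in> tangent_space A p" for p using assms by (auto simp: fscale_def)
  show "smooth_fun_on A W (dir_deriv (fscale h X) f)" if f: "smooth_fun_on A W f" for W f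
    using smooth_fun_on_mult[OF smooth_fun_on_subset[OF assms(2) smooth_fun_on_open[OF f]] vector_field_smooth[OF assms(1) f]]
    by (simp add: dir_deriv_def fscale_def tscale_def)
qed

lemma fscale_minus_one: "fscale (\<lambda>_. -1) X = - X"
  by (simp add: fscale_def tscale_def fun_eq_iff)

text \<open>The commutator is a priori of second order and has to be exhibited as the velocity of a
  curve. In a chart the second order terms cancel by the symmetry of second derivatives, and a
  directional derivative remains.\<close>

lemma lie_bracket_tangent:
  assumes X: "vector_field A X" and Y: "vector_field A Y"
  shows "lie_bracket A X Y p \<in> tangent_space A p"
proof -
  obtain U \<phi> where U: "(U, \<phi>) \<in> A" "p \<in> U" using chart_ex by blast
  let ?i = "inv_into U \<phi>"
  \<comment> \<open>The coordinate expression of the field \<open>Z\<close>: its components are the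
    values of \<open>Z\<close> on the coordinate functions.\<close>
  define co where "co Z y = (\<Sum>b\<in>Basis. Z (?i y) (\<lambda>x. \<phi> x \<bullet> b) *\<^sub>R b)" for Z :: "'a field" and y
  have co_smooth: "smooth_on (\<phi> ` U) (co Z)" if "vector_field A Z" for Z
    using smooth_fun_on_chart[OF vector_field_smooth[OF that smooth_fun_on_coordinate[OF U(1)]] U(1)] chart(2)[OF U(1)]
    unfolding co_def dir_deriv_def by (intro smooth_on_sum smooth_on_scaleR) auto
  have co: "Z q f = frechet_derivative (\<lambda>y. f (?i y)) (at (\<phi> q)) (co Z (\<phi> q))"
    if Z: "vector_field A Z" and q: "q \<in> U" "smooth_fun_near A q f" for Z q f
  proof -
    obtain w where w: "Z q = tvec U \<phi> q w" using tangent_space_eq[OF U(1) q(1)] vector_field_tangent[OF Z] by blast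
    then have "co Z (\<phi> q) = w" using U(1) q(1) by (simp add: co_def tvec_coordinate euclidean_representation)
    then show ?thesis using q w by (simp add: tvec_def)
  qed
  \<comment> \<open>The classical coordinate formula for the bracket: the derivative of
    \<open>Y\<close> along \<open>X\<close> minus that of \<open>X\<close> along
    \<open>Y\<close>.\<close>
  let ?w = "frechet_derivative (co Y) (at (\<phi> p)) (co X (\<phi> p)) - frechet_derivative (co X) (at (\<phi> p)) (co Y (\<phi> p))"
  have "lie_bracket A X Y p f = tvec U \<phi> p ?w f" for f
  proof (cases "smooth_fun_near A p f")
    case True
    then obtain W where W: "p \<in> W" "smooth_fun_on A W f" unfolding smooth_fun_near_def by blast
    let ?f = "\<lambda>y. f (?i y)"
    let ?S = "\<phi> ` (U \<inter> W)"
    have S: "open ?S" "\<phi> p \<in> ?S"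
      using chart_open_image[OF U(1) smooth_fun_on_open[OF W(2)]] U W by auto
    have f: "smooth_on ?S ?f" by (rule smooth_fun_on_chart[OF W(2) U(1)])
    note lin = linear_frechet_derivative[OF smooth_on_differentiable[OF S(1) f S(2)]]
    have sec: "Z p (dir_deriv Z' f) = frechet_derivative ?f (at (\<phi> p)) (frechet_derivative (co Z') (at (\<phi> p)) (co Z (\<phi> p)))
        + frechet_derivative (\<lambda>y. frechet_derivative ?f (at y) (co Z (\<phi> p))) (at (\<phi> p)) (co Z' (\<phi> p))"
      if Z: "vector_field A Z" "vector_field A Z'" for Z Z'
    proof -
      have s: "smooth_on ?S (co Z')" by (rule smooth_on_subset[OF co_smooth[OF Z(2)]]) auto
      have n: "smooth_fun_near A p (dir_deriv Z' f)" by (rule vector_field_near[OF Z(2) True])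
      have "dir_deriv Z' f (?i y) = frechet_derivative ?f (at y) (co Z' y)" if "y \<in> ?S" for y
        using that U(1) co[OF Z(2) _ smooth_fun_nearI[OF W(2)]] by (auto simp: dir_deriv_def)
      then have "frechet_derivative (\<lambda>y. dir_deriv Z' f (?i y)) (at (\<phi> p))
        = frechet_derivative (\<lambda>y. frechet_derivative ?f (at y) (co Z' y)) (at (\<phi> p))"
        by (intro frechet_derivative_transform_within_open[OF smooth_fun_near_differentiable[OF n U] S])
      then show ?thesis
        using co[OF Z(1) U(2) n] frechet_derivative_along_field[OF S f s] by simp
    qed
    show ?thesis
      using True sec[OF X Y] sec[OF Y X] frechet_derivative_commute[OF S f, of "co X (\<phi> p)" "co Y (\<phi> p)"]
      by (simp add: lie_bracket_def tvec_def linear_diff[OF lin])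
  qed (simp add: lie_bracket_def tvec_def)
  then have "lie_bracket A X Y p = tvec U \<phi> p ?w" by auto
  then show ?thesis using tvec_in_tangent_space[OF U] by simp
qed

lemma lie_bracket_apply:
  "smooth_fun_near A p f \<Longrightarrow> lie_bracket A X Y p f = X p (dir_deriv Y f) - Y p (dir_deriv X f)"
  by (simp add: lie_bracket_def)

lemma lie_bracket_apply_on:
  assumes "smooth_fun_on A W f" "p \<in> W"
  shows "dir_deriv (lie_bracket A X Y) f p = dir_deriv X (dir_deriv Y f) p - dir_deriv Y (dir_deriv X f) p"
  using smooth_fun_nearI[OF assms] by (simp add: lie_bracket_def dir_deriv_def)

lemma vector_field_lie_bracket [intro]:
  assumes "vector_field A X" "vector_field A Y" shows "vector_field A (lie_bracket A X Y)"
  unfolding vector_field_def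
proof (intro conjI allI impI)
  show "lie_bracket A X Y p \<in> tangent_space A p" for p by (rule lie_bracket_tangent[OF assms])
  fix W f assume f: "smooth_fun_on A W f"
  have "smooth_fun_on A W (\<lambda>p. dir_deriv X (dir_deriv Y f) p - dir_deriv Y (dir_deriv X f) p)"
    using f assms by (intro smooth_fun_on_diff) auto
  then show "smooth_fun_on A W (dir_deriv (lie_bracket A X Y) f)"
    by (rule smooth_fun_on_cong) (simp add: lie_bracket_apply_on[OF f])
qed

lemma lie_bracket_commute: "lie_bracket A X Y = - lie_bracket A Y X"
  by (auto simp: lie_bracket_def fun_eq_iff)

lemma tangent_eqI:
  assumes "u \<in> tangent_space A p" "v \<in> tangent_space A p" "\<And>f. smooth_fun_near A p f \<Longrightarrow> u f = v f"
  shows "u = v"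
  using assms tangent_not_near by (metis ext)

lemma lie_bracket_add_right:
  assumes "vector_field A X" "vector_field A Y" "vector_field A Z"
  shows "lie_bracket A X (Y + Z) = lie_bracket A X Y + lie_bracket A X Z"
proof (rule ext, rule tangent_eqI)
  fix p f assume f: "smooth_fun_near A p f"
  have "X p (\<lambda>q. dir_deriv Y f q + dir_deriv Z f q) = X p (dir_deriv Y f) + X p (dir_deriv Z f)"
    by (rule tangent_sum_fun) (use assms f vector_field_near in auto)
  then show "lie_bracket A X (Y + Z) p f = (lie_bracket A X Y + lie_bracket A X Z) p f"
    using f by (simp add: lie_bracket_def dir_deriv_def)
qed (use assms in auto)

lemma lie_bracket_fscale_right:
  assumes "vector_field A X" "vector_field A Y" "smooth_fun_on A UNIV h"
  shows "lie_bracket A X (fscale h Y) = fscale (dir_deriv X h) Y + fscale h (lie_bracket A X Y)"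
proof (rule ext, rule tangent_eqI)
  fix p f assume f: "smooth_fun_near A p f"
  have "X p (\<lambda>q. h q * dir_deriv Y f q) = h p * X p (dir_deriv Y f) + X p h * dir_deriv Y f p"
    by (rule tangent_mult_fun) (use assms f vector_field_near in \<open>auto intro: smooth_fun_nearI\<close>)
  then show "lie_bracket A X (fscale h Y) p f = (fscale (dir_deriv X h) Y + fscale h (lie_bracket A X Y)) p f"
    using f by (simp add: lie_bracket_def dir_deriv_def fscale_def tscale_def algebra_simps)
next
  show "(fscale (dir_deriv X h) Y + fscale h (lie_bracket A X Y)) p \<in> tangent_space A p" for p
    using assms by (auto simp: fscale_def)
qed (use assms in auto)

lemma lie_bracket_jacobi:
  assumes "vector_field A X" "vector_field A Y" "vector_field A Z"
  shows "lie_bracket A X (lie_bracket A Y Z) + lie_bracket A Y (lie_bracket A Z X) + lie_bracket A Z (lie_bracket A X Y) = 0"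
proof (rule ext, rule tangent_eqI)
  fix p f assume f: "smooth_fun_near A p f"
  then obtain W where W: "p \<in> W" "smooth_fun_on A W f" unfolding smooth_fun_near_def by blast
  have e: "P p (dir_deriv (lie_bracket A Q R) f) = P p (dir_deriv Q (dir_deriv R f)) - P p (dir_deriv R (dir_deriv Q f))"
    if "vector_field A P" "vector_field A Q" "vector_field A R" for P Q R
  proof -
    have "P p (dir_deriv (lie_bracket A Q R) f) = P p (\<lambda>q. dir_deriv Q (dir_deriv R f) q - dir_deriv R (dir_deriv Q f) q)"
      \<comment> \<open>The commutator formula for the bracket is available on the neighbourhood
        \<open>W\<close> only, so the locality of the tangent vector \<open>P p\<close> is
        used.\<close>
      by (rule tangent_cong[OF _ _ smooth_fun_on_open[OF W(2)] W(1)])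
        (use that f in \<open>auto intro!: vector_field_near simp: lie_bracket_apply_on[OF W(2)]\<close>)
    also have "\<dots> = P p (dir_deriv Q (dir_deriv R f)) - P p (dir_deriv R (dir_deriv Q f))"
      by (rule tangent_diff_fun) (use that f in \<open>auto intro!: vector_field_near\<close>)
    finally show ?thesis .
  qed
  have e': "lie_bracket A Q R p (dir_deriv P f) = Q p (dir_deriv R (dir_deriv P f)) - R p (dir_deriv Q (dir_deriv P f))"
    if "vector_field A P" for P Q R
    by (rule lie_bracket_apply[OF vector_field_near[OF that f]])
  show "(lie_bracket A X (lie_bracket A Y Z) + lie_bracket A Y (lie_bracket A Z X) + lie_bracket A Z (lie_bracket A X Y)) p f = 0 p f"
    using f assms by (simp add: lie_bracket_apply e e')
qed (use assms in \<open>auto intro!: tangent_add tangent_zero lie_bracket_tangent\<close>)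

end

section \<open>Left invariant fields on a Lie group\<close>

locale lie_group_manifold =
  fixes A :: "('a::{topological_group_add, t2_space, second_countable_topology}, 'e::euclidean_space) chart set"
  assumes lie: "lie_group A"
begin

sublocale smooth_manifold A
  by unfold_locales (use lie in \<open>simp add: lie_group_def\<close>)

section \<open>Multiplication and translations in charts\<close>

definition mult_in :: "'a set \<Rightarrow> ('a \<Rightarrow> 'e) \<Rightarrow> 'a set \<Rightarrow> ('a \<Rightarrow> 'e) \<Rightarrow> 'e \<times> 'e \<Rightarrow> 'a" where
  "mult_in U \<phi> V \<psi> z = inv_into U \<phi> (fst z) + inv_into V \<psi> (snd z)"

lemma mult_in_open:
  assumes U: "(U, \<phi>) \<in> A" and V: "(V, \<psi>) \<in> A" and W: "open W"
  shows "open {z \<in> \<phi> ` U \<times> \<psi> ` V. mult_in U \<phi> V \<psi> z \<in> W}"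
proof -
  have "continuous_on (\<phi> ` U \<times> \<psi> ` V) (\<lambda>z. inv_into U \<phi> (fst z))"
    "continuous_on (\<phi> ` U \<times> \<psi> ` V) (\<lambda>z. inv_into V \<psi> (snd z))"
    by (rule continuous_on_compose2[OF chart_continuous(2)[OF U]] continuous_on_compose2[OF chart_continuous(2)[OF V]];
      force intro: continuous_intros)+
  then have "continuous_on (\<phi> ` U \<times> \<psi> ` V) (mult_in U \<phi> V \<psi>)"
    unfolding mult_in_def by (rule continuous_on_add)
  from continuous_open_preimage[OF this open_Times[OF chart(2)[OF U] chart(2)[OF V]] W]
  show ?thesis by (simp add: vimage_def Int_def)
qed

lemma mult_in_chart:
  assumes U: "(U, \<phi>) \<in> A" and V: "(V, \<psi>) \<in> A" and W: "(W, \<theta>) \<in> A"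
  shows "smooth_on {z \<in> \<phi> ` U \<times> \<psi> ` V. mult_in U \<phi> V \<psi> z \<in> W} (\<lambda>z. \<theta> (mult_in U \<phi> V \<psi> z))"
proof -
  have "\<forall>(U, \<phi>)\<in>A. \<forall>(V, \<psi>)\<in>A. \<forall>(W, \<theta>)\<in>A.
        smooth_on (map_prod \<phi> \<psi> ` {(x, y). x \<in> U \<and> y \<in> V \<and> x + y \<in> W})
          (\<lambda>(a, b). \<theta> (inv_into U \<phi> a + inv_into V \<psi> b))"
    using lie unfolding lie_group_def by (elim conjE)
  from bspec[OF this U] have "\<forall>(V, \<psi>)\<in>A. \<forall>(W, \<theta>)\<in>A.
        smooth_on (map_prod \<phi> \<psi> ` {(x, y). x \<in> U \<and> y \<in> V \<and> x + y \<in> W})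
          (\<lambda>(a, b). \<theta> (inv_into U \<phi> a + inv_into V \<psi> b))"
    by simp
  from bspec[OF this V] have "\<forall>(W, \<theta>)\<in>A.
        smooth_on (map_prod \<phi> \<psi> ` {(x, y). x \<in> U \<and> y \<in> V \<and> x + y \<in> W})
          (\<lambda>(a, b). \<theta> (inv_into U \<phi> a + inv_into V \<psi> b))"
    by simp
  from bspec[OF this W]
  have "smooth_on (map_prod \<phi> \<psi> ` {(x, y). x \<in> U \<and> y \<in> V \<and> x + y \<in> W})
          (\<lambda>z. \<theta> (mult_in U \<phi> V \<psi> z))"
    by (simp add: mult_in_def case_prod_unfold)
  moreover have "map_prod \<phi> \<psi> ` {(x, y). x \<in> U \<and> y \<in> V \<and> x + y \<in> W}
      = {z \<in> \<phi> ` U \<times> \<psi> ` V. mult_in U \<phi> V \<psi> z \<in> W}" (is "?L = ?R")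
  proof
    show "?L \<subseteq> ?R" using U V by (auto simp: mult_in_def)
    show "?R \<subseteq> ?L"
    proof
      fix z assume "z \<in> ?R"
      then obtain x y where xy: "z = (\<phi> x, \<psi> y)" "x \<in> U" "y \<in> V" "mult_in U \<phi> V \<psi> z \<in> W" by auto
      then have "x + y \<in> W" using U V by (simp add: mult_in_def)
      then show "z \<in> ?L" using xy by (intro image_eqI[of _ _ "(x, y)"]) auto
    qed
  qed
  ultimately show ?thesis by simp
qed

lemma smooth_fun_mult_in:
  assumes U: "(U, \<phi>) \<in> A" and V: "(V, \<psi>) \<in> A" and f: "smooth_fun_on A W f"
  shows "smooth_on {z \<in> \<phi> ` U \<times> \<psi> ` V. mult_in U \<phi> V \<psi> z \<in> W} (\<lambda>z. f (mult_in U \<phi> V \<psi> z))"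
proof (rule smooth_on_local)
  let ?m = "mult_in U \<phi> V \<psi>"
  fix z assume z: "z \<in> {z \<in> \<phi> ` U \<times> \<psi> ` V. ?m z \<in> W}"
  obtain X \<theta> where X: "(X, \<theta>) \<in> A" "?m z \<in> X" using chart_ex by blast
  let ?T = "{z \<in> \<phi> ` U \<times> \<psi> ` V. ?m z \<in> X \<inter> W}"
  have W: "open W" by (rule smooth_fun_on_open[OF f])
  have T: "open ?T" by (rule mult_in_open[OF U V open_Int[OF chart(1)[OF X(1)] W]])
  have "smooth_on ?T (\<lambda>z. \<theta> (?m z))" by (rule smooth_on_subset[OF mult_in_chart[OF U V X(1)]]) auto
  then have "smooth_on ?T (\<lambda>z. f (inv_into X \<theta> (\<theta> (?m z))))"
    by (rule smooth_on_compose[OF T chart_open_image[OF X(1) W] smooth_fun_on_chart[OF f X(1)]]) auto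
  then have "smooth_on ?T (\<lambda>z. f (?m z))" by (rule smooth_on_cong[OF T]) (simp add: X(1))
  moreover have "z \<in> ?T" using z X(2) by simp
  ultimately show "\<exists>T. open T \<and> z \<in> T \<and> smooth_on T (\<lambda>z. f (?m z))" using T by blast
qed

lemma open_translate: "open W \<Longrightarrow> open {x. (p::'a) + x \<in> W}"
proof -
  assume W: "open W"
  have "continuous_on UNIV (\<lambda>x. p + x)" by (rule continuous_on_add[OF continuous_on_const continuous_on_id])
  from open_vimage[OF W this] show ?thesis by (simp add: vimage_def)
qed

lemma smooth_fun_translate:
  assumes f: "smooth_fun_on A W f"
  shows "smooth_fun_on A {x. p + x \<in> W} (\<lambda>x. f (p + x))"
proof (rule smooth_fun_onI)
  show W: "open {x. p + x \<in> W}" by (rule open_translate[OF smooth_fun_on_open[OF f]])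
  fix V \<psi> assume V: "(V, \<psi>) \<in> A"
  obtain U \<phi> where U: "(U, \<phi>) \<in> A" "p \<in> U" using chart_ex by blast
  have S: "open (\<psi> ` (V \<inter> {x. p + x \<in> W}))" by (rule chart_open_image[OF V W])
  \<comment> \<open>Left translation is the multiplication with its first coordinate frozen at
    \<open>\<phi> p\<close>.\<close>
  have "smooth_on (\<psi> ` (V \<inter> {x. p + x \<in> W})) (\<lambda>b. f (mult_in U \<phi> V \<psi> (\<phi> p, b)))"
    by (rule smooth_on_compose[OF S mult_in_open[OF U(1) V smooth_fun_on_open[OF f]] smooth_fun_mult_in[OF U(1) V f]])
      (use U V S in \<open>auto simp: mult_in_def intro!: smooth_on_Pair\<close>)
  then show "smooth_on (\<psi> ` (V \<inter> {x. p + x \<in> W})) (\<lambda>y. f (p + inv_into V \<psi> y))"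
    using U by (simp add: mult_in_def)
qed

lemma smooth_fun_near_translate:
  "smooth_fun_near A (p + q) f \<longleftrightarrow> smooth_fun_near A q (\<lambda>x. f (p + x))"
proof -
  have *: "smooth_fun_near A q (\<lambda>x. f (p + x))" if f: "smooth_fun_near A (p + q) f" for p q f
  proof -
    obtain W where "p + q \<in> W" "smooth_fun_on A W f" using f unfolding smooth_fun_near_def by blast
    then show ?thesis by (intro smooth_fun_nearI[OF smooth_fun_translate]) auto
  qed
  \<comment> \<open>The converse is the same statement for the translation by
    \<open>- p\<close>.\<close>
  show ?thesis using *[of p q f] *[of "- p" "p + q" "\<lambda>x. f (p + x)"] by (auto simp flip: add.assoc)
qed

lemma push_left_velocity:
  assumes c: "smooth_curve A c"
  shows "smooth_curve A (\<lambda>t. p + c t)" "velocity A (\<lambda>t. p + c t) = push_left p (velocity A c)"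
proof -
  obtain \<epsilon> where \<epsilon>: "\<epsilon> > 0" "continuous_on {-\<epsilon><..<\<epsilon>} c"
    "\<forall>(U, \<phi>)\<in>A. smooth_on {t \<in> {-\<epsilon><..<\<epsilon>}. c t \<in> U} (\<phi> \<circ> c)"
    using c unfolding smooth_curve_def by blast
  show "smooth_curve A (\<lambda>t. p + c t)"
  proof (rule smooth_curveI[OF \<epsilon>(1)])
    show "continuous_on {-\<epsilon><..<\<epsilon>} (\<lambda>t. p + c t)" by (intro continuous_intros \<epsilon>)
    fix U \<phi> b assume U: "(U, \<phi>) \<in> A"
    show "smooth_on {t \<in> {-\<epsilon><..<\<epsilon>}. p + c t \<in> U} (\<lambda>t. \<phi> (p + c t) \<bullet> b)"
      using smooth_fun_along_curve[OF \<epsilon>(2) _ \<epsilon>(3) smooth_fun_translate[OF smooth_fun_on_coordinate[OF U], of p b]]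
      by simp
  qed
  show "velocity A (\<lambda>t. p + c t) = push_left p (velocity A c)"
    by (simp add: velocity_def push_left_def fun_eq_iff comp_def smooth_fun_near_translate)
qed

lemma push_left_tangent [intro]:
  assumes "v \<in> tangent_space A q"
  shows "push_left p v \<in> tangent_space A (p + q)"
proof -
  obtain c where c: "smooth_curve A c" "c 0 = q" "v = velocity A c"
    using assms unfolding tangent_space_def by blast
  then show ?thesis unfolding tangent_space_def
    by (intro CollectI exI[of _ "\<lambda>t. p + c t"]) (simp add: push_left_velocity)
qed

lemma push_left_assoc: "push_left (p::'a) (push_left q v) = push_left (p + q) v"
  by (simp add: push_left_def add.assoc)

lemma push_left_zero: "push_left (0::'a) v = v"
  by (simp add: push_left_def)

section \<open>Left invariant fields\<close>

definition left_invariant :: "'a field \<Rightarrow> bool" where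
  "left_invariant X \<longleftrightarrow> (\<forall>p q. X (p + q) = push_left p (X q))"

definition left_field :: "'a tangent \<Rightarrow> 'a field" where
  "left_field v = (\<lambda>p. push_left p v)"

lemma left_invariant_left_field: "left_invariant (left_field v)"
  by (simp add: left_invariant_def left_field_def push_left_assoc)

lemma left_invariant_eq_left_field: "left_invariant X \<Longrightarrow> X = left_field (X 0)"
  unfolding left_invariant_def left_field_def by (metis add.right_neutral)

lemma left_invariant_lie_bracket:
  assumes "left_invariant X" "left_invariant Y"
  shows "left_invariant (lie_bracket A X Y)"
  using assms unfolding left_invariant_def
  by (auto simp: lie_bracket_def fun_eq_iff push_left_def smooth_fun_near_translate dir_deriv_def)

text \<open>The value of the field on \<open>f\<close> at \<open>p\<close> is the derivative of
  \<open>f (p + x)\<close> in \<open>x\<close> at \<open>x = 0\<close>. It is thus a partial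
  derivative, in the direction \<open>(0, w)\<close>, of the smooth function
  \<open>f (x + y)\<close> on the product, which depends smoothly on the first variable.\<close>

lemma vector_field_left_field [intro]:
  assumes v: "v \<in> tangent_space A 0"
  shows "vector_field A (left_field v)"
  unfolding vector_field_def
proof (intro conjI allI impI)
  show "left_field v p \<in> tangent_space A p" for p
    using push_left_tangent[OF v, of p] by (simp add: left_field_def)
  fix W f assume f: "smooth_fun_on A W f"
  have W: "open W" by (rule smooth_fun_on_open[OF f])
  obtain V \<psi> w where V: "(V, \<psi>) \<in> A" "0 \<in> V" and w: "v = tvec V \<psi> 0 w" using tangentE[OF v] .
  show "smooth_fun_on A W (dir_deriv (left_field v) f)"
  proof (rule smooth_fun_onI[OF W])
    fix U \<phi> assume U: "(U, \<phi>) \<in> A"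
    let ?m = "mult_in U \<phi> V \<psi>"
    let ?G = "\<lambda>z. f (?m z)"
    let ?S = "{z \<in> \<phi> ` U \<times> \<psi> ` V. ?m z \<in> W}"
    have S: "open ?S" by (rule mult_in_open[OF U V(1) W])
    have G: "smooth_on ?S ?G" by (rule smooth_fun_mult_in[OF U V(1) f])
    have T: "open (\<phi> ` (U \<inter> W))" by (rule chart_open_image[OF U W])
    have im: "(\<lambda>a. (a, \<psi> 0)) ` (\<phi> ` (U \<inter> W)) \<subseteq> ?S" using U V by (auto simp: mult_in_def)
    have "smooth_on (\<phi> ` (U \<inter> W)) (\<lambda>a. frechet_derivative ?G (at (a, \<psi> 0)) (0, w))"
      by (rule smooth_on_compose[OF T S smooth_on_frechet_derivative[OF G] _ im]) (intro smooth_on_Pair T smooth_on_ident smooth_on_const)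
    moreover have "frechet_derivative ?G (at (a, \<psi> 0)) (0, w) = dir_deriv (left_field v) f (inv_into U \<phi> a)"
      if a: "a \<in> \<phi> ` (U \<inter> W)" for a
    proof -
      have "?G differentiable at (a, \<psi> 0)"
        by (rule smooth_on_differentiable[OF S G]) (use im a in blast)
      then have "(?G has_derivative frechet_derivative ?G (at (a, \<psi> 0))) (at (a, \<psi> 0))" by (rule has_derivative_frechet)
      moreover have "((\<lambda>b. (a, b)) has_derivative (\<lambda>b. (0, b))) (at (\<psi> 0))"
        by (auto intro!: derivative_eq_intros)
      ultimately have "((\<lambda>b. ?G (a, b)) has_derivative (\<lambda>b. frechet_derivative ?G (at (a, \<psi> 0)) (0, b))) (at (\<psi> 0))"
        using has_derivative_compose by blast
      then have "frechet_derivative (\<lambda>b. ?G (a, b)) (at (\<psi> 0)) = (\<lambda>b. frechet_derivative ?G (at (a, \<psi> 0)) (0, b))"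
        by (rule frechet_derivative_eqI)
      moreover have "smooth_fun_near A 0 (\<lambda>x. f (inv_into U \<phi> a + x))"
        using a U smooth_fun_near_translate[of "inv_into U \<phi> a" 0 f] smooth_fun_nearI[OF f] by auto
      ultimately show ?thesis
        by (simp add: dir_deriv_def left_field_def push_left_def w tvec_def mult_in_def fun_eq_iff)
    qed
    ultimately show "smooth_on (\<phi> ` (U \<inter> W)) (\<lambda>y. dir_deriv (left_field v) f (inv_into U \<phi> y))"
      by (rule smooth_on_cong[OF T])
  qed
qed

end

section \<open>Lie algebras with a flat Gauduchon connection\<close>

definition cmul :: "complex \<Rightarrow> complex \<times> complex \<Rightarrow> complex \<times> complex" where
  "cmul c x = (c * fst x, c * snd x)"

definition herm :: "complex \<times> complex \<Rightarrow> complex \<times> complex \<Rightarrow> complex" where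
  "herm x y = fst x * cnj (fst y) + snd x * cnj (snd y)"

definition cdet :: "complex \<times> complex \<Rightarrow> complex \<times> complex \<Rightarrow> complex" where
  "cdet x y = fst x * snd y - snd x * fst y"

text \<open>The quaternionic structure of C^2, antilinear with square -1. It represents the
  determinant: \<open>herm z (csig x) = cdet x z\<close>. Hence the adjoint of
  \<open>y \<mapsto> cdet x y w\<close> is \<open>z \<mapsto> herm z w\<close> times
  \<open>csig x\<close>.\<close>

definition csig :: "complex \<times> complex \<Rightarrow> complex \<times> complex" where
  "csig x = (- cnj (snd x), cnj (fst x))"

text \<open>The torsion of the \<open>s\<close>-Gauduchon connection if the Chern torsion is \<open>cdet x y\<close> times \<open>w\<close>.\<close>

definition tors :: "real \<Rightarrow> complex \<times> complex \<Rightarrow> complex \<times> complex \<Rightarrow> complex \<times> complex \<Rightarrow> complex \<times> complex" where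
  "tors s w x y = cmul ((1 - s) * cdet x y) w
     + cmul (s / 2) (cmul (herm y w) (csig x) - cmul (herm x w) (csig y))"

lemmas alg_defs = cmul_def herm_def cdet_def csig_def tors_def

text \<open>Flatness rewrites the connection along a bracket as a commutator. When the double
  brackets of the Jacobi identity are expanded, all second order terms in D cancel in the cyclic
  sum; the terms with one D form the covariant derivative of T.\<close>

lemma first_bianchi:
  fixes D T br :: "'v::ab_group_add \<Rightarrow> 'v \<Rightarrow> 'v"
  assumes D: "\<And>x y z. D x (y + z) = D x y + D x z"
    and T: "\<And>x y z. T x (y + z) = T x y + T x z" "\<And>x y. T x y = - T y x"
    and br: "\<And>x y. br x y = D x y - D y x - T x y"
    and flat: "\<And>x y z. D (br x y) z = D x (D y z) - D y (D x z)"
    and jac: "\<And>x y z. br x (br y z) + br y (br z x) + br z (br x y) = 0"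
  shows "(D x (T y z) - T (D x y) z - T y (D x z))
       + (D y (T z x) - T (D y z) x - T z (D y x))
       + (D z (T x y) - T (D z x) y - T x (D z y))
       = T x (T y z) + T y (T z x) + T z (T x y)"
proof -
  have Dm: "D u (- v) = - D u v" for u v
    using D[of u v "-v"] D[of u 0 0] by (simp add: eq_neg_iff_add_eq_0 add.commute)
  have Tm: "T u (- v) = - T u v" for u v
    using T(1)[of u v "-v"] T(1)[of u 0 0] by (simp add: eq_neg_iff_add_eq_0 add.commute)
  have Dd: "D u (v - v') = D u v - D u v'" for u v v' using D[of u v "-v'"] by (simp add: Dm)
  have Td: "T u (v - v') = T u v - T u v'" for u v v' using T(1)[of u v "-v'"] by (simp add: Tm)
  have e: "br u (br v w) = D u (D v w) - D u (D w v) - D u (T v w) - D v (D w u) + D w (D v u)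
      - T u (D v w) + T u (D w v) + T u (T v w)" for u v w
  proof -
    have 1: "D u (br v w) = D u (D v w) - D u (D w v) - D u (T v w)" by (simp add: br Dd)
    have 2: "T u (br v w) = T u (D v w) - T u (D w v) - T u (T v w)" by (simp add: br Td)
    show ?thesis using br[of u "br v w"] unfolding flat 1 2 by (simp add: algebra_simps)
  qed
  show ?thesis
    using jac[of x y z] T(2)[of "D x y" z] T(2)[of "D y z" x] T(2)[of "D z x" y]
    by (simp add: e algebra_simps)
qed

lemma skew_hermitian_matrix:
  assumes add: "\<And>y z. A (y + z) = A y + A z" and lin: "\<And>c y. A (cmul c y) = cmul c (A y)"
    and skew: "\<And>y z. herm (A y) z + herm y (A z) = 0"
  obtains \<alpha> \<delta> :: real and \<beta> :: complex
  where "\<And>y. A y = (\<i> * \<alpha> * fst y - cnj \<beta> * snd y, \<beta> * fst y + \<i> * \<delta> * snd y)"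
proof -
  define p q where "p = A (1,0)" "q = A (0,1)"
  have A: "A y = cmul (fst y) p + cmul (snd y) q" for y
  proof -
    have "y = cmul (fst y) (1,0) + cmul (snd y) (0,1)" by (simp add: cmul_def)
    then show ?thesis using add lin p_q_def by metis
  qed
  have 1: "fst p + cnj (fst p) = 0" "snd q + cnj (snd q) = 0" "fst q + cnj (snd p) = 0"
    using skew[of "(1,0)" "(1,0)"] skew[of "(0,1)" "(0,1)"] skew[of "(0,1)" "(1,0)"]
    by (simp_all add: herm_def p_q_def)
  have "fst p = \<i> * Im (fst p)" "snd q = \<i> * Im (snd q)" "fst q = - cnj (snd p)"
    using 1 by (auto simp: complex_eq_iff)
  then have "A y = (\<i> * Im (fst p) * fst y - cnj (snd p) * snd y, snd p * fst y + \<i> * Im (snd q) * snd y)" for y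
    unfolding A cmul_def by (simp add: mult.commute prod_eq_iff)
  then show thesis by (rule that)
qed

lemma flat_imp_torsion_zero_normalized:
  fixes a s :: real
  assumes D: "\<And>x y z. D (x + y) z = D x z + D y z" "\<And>x y z. D x (y + z) = D x y + D x z"
      "\<And>r x y. D (r *\<^sub>R x) y = r *\<^sub>R D x y"
      "\<And>c x y. D x (cmul c y) = cmul c (D x y)" "\<And>x y z. herm (D x y) z + herm y (D x z) = 0"
    and br: "\<And>x y. br x y = D x y - D y x - tors s (complex_of_real a, 0) x y"
    and flat: "\<And>x y z. D (br x y) z = D x (D y z) - D y (D x z)"
    and jac: "\<And>x y z. br x (br y z) + br y (br z x) + br z (br x y) = 0"
    and s: "s \<noteq> 0" "s \<noteq> 2"
  shows "a = 0"
proof (rule ccontr)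
  assume a: "a \<noteq> 0"
  have "\<exists>\<alpha> \<delta> \<beta>. \<forall>y. D x y = (\<i> * complex_of_real \<alpha> * fst y - cnj \<beta> * snd y, \<beta> * fst y + \<i> * complex_of_real \<delta> * snd y)" for x
    using skew_hermitian_matrix[of "D x"] D by metis
  then obtain \<alpha> \<delta> \<beta> where M: "\<And>x y. D x y = (\<i> * complex_of_real (\<alpha> x) * fst y - cnj (\<beta> x) * snd y,
      \<beta> x * fst y + \<i> * complex_of_real (\<delta> x) * snd y)"
    by metis
  let ?T = "tors s (complex_of_real a, 0)"
  \<comment> \<open>\<open>herm\<close> is parallel, while differentiating \<open>cdet\<close>
    subtracts the trace of \<open>D x\<close>, that is \<open>\<i>\<close> times
    \<open>\<alpha> x + \<delta> x\<close>. So the derivative of the torsion replaces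
    \<open>w = (a, 0)\<close> by \<open>D x w\<close> minus the trace times \<open>w\<close>; in
    this vector \<open>\<alpha>\<close> cancels.\<close>
  have DT: "D x (?T y z) - ?T (D x y) z - ?T y (D x z)
      = tors s (- \<i> * \<delta> x * a, \<beta> x * a) y z" for x y z
    unfolding M by (simp add: alg_defs algebra_simps)
  define P where "P x y z = tors s (- \<i> * \<delta> x * a, \<beta> x * a) y z + tors s (- \<i> * \<delta> y * a, \<beta> y * a) z x
    + tors s (- \<i> * \<delta> z * a, \<beta> z * a) x y - (?T x (?T y z) + ?T y (?T z x) + ?T z (?T x y))" for x y z
  have "(D x (?T y z) - ?T (D x y) z - ?T y (D x z)) + (D y (?T z x) - ?T (D y z) x - ?T z (D y x))
       + (D z (?T x y) - ?T (D z x) y - ?T x (D z y)) = ?T x (?T y z) + ?T y (?T z x) + ?T z (?T x y)" for x y z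
    by (rule first_bianchi[of D ?T br]) (use D br flat jac in \<open>auto simp: alg_defs algebra_simps\<close>)
  then have P: "P x y z = 0" for x y z unfolding DT P_def by simp
  define e1 :: "complex \<times> complex" where "e1 = (1,0)"
  define f1 :: "complex \<times> complex" where "f1 = (\<i>,0)"
  define e2 :: "complex \<times> complex" where "e2 = (0,1)"
  define f2 :: "complex \<times> complex" where "f2 = (0,\<i>)"
  \<comment> \<open>\<open>k\<close> and \<open>h\<close> weight the two parts of the torsion and
    \<open>c = k + h\<close> is the share of the Chern connection. Kept as atoms, they leave
    polynomial equations.\<close>
  define c k h where "c = 1 - s / 2" and "k = 1 - s" and "h = s / 2"
  have ev: "tors s w x y = cmul (of_real k * cdet x y) w
      + cmul (of_real h) (cmul (herm y w) (csig x) - cmul (herm x w) (csig y))" for w x y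
    by (simp add: tors_def k_def h_def)
  note ev = ev cmul_def herm_def cdet_def csig_def e1_def f1_def e2_def f2_def
  \<comment> \<open>These components of the Bianchi identity decouple: the first four contain only
    \<open>\<delta> f2\<close>, \<open>Re (\<beta> e1)\<close> and \<open>Im (\<beta> f1)\<close>,
    the last four only \<open>\<beta> e2\<close> and \<open>\<beta> f2\<close>.\<close>
  have eqs: "a * ((h - k) * \<delta> f2 - 2 * h * Re (\<beta> e1)) = 0"
    "a * ((k - h) * \<delta> f2 - 2 * h * Im (\<beta> f1)) = 0"
    "a * ((k - h) * (Re (\<beta> e1) - Im (\<beta> f1)) - 4 * h * a * (k + h)) = 0"
    "a * ((k - h) * (Re (\<beta> e1) - Im (\<beta> f1)) + 2 * h * \<delta> f2) = 0"
    "a * ((k - h) * Im (\<beta> e2) + (k + h) * Re (\<beta> f2)) = 0"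
    "a * ((k + h) * Im (\<beta> e2) + (k - h) * Re (\<beta> f2)) = 0"
    "a * ((k - h) * Im (\<beta> f2) - (k + h) * Re (\<beta> e2)) = 0"
    "a * ((k - h) * Re (\<beta> e2) - (k + h) * Im (\<beta> f2)) = 0"
  proof -
    have "a * ((h - k) * \<delta> f2 - 2 * h * Re (\<beta> e1)) = Im (fst (P e1 e2 f2))"
      "a * ((k - h) * \<delta> f2 - 2 * h * Im (\<beta> f1)) = Re (fst (P f1 e2 f2))"
      "a * ((k - h) * (Re (\<beta> e1) - Im (\<beta> f1)) - 4 * h * a * (k + h)) = Im (snd (P e1 f1 e2))"
      "a * ((k - h) * (Re (\<beta> e1) - Im (\<beta> f1)) + 2 * h * \<delta> f2) = - Re (snd (P e1 f1 f2))"
      "a * ((k - h) * Im (\<beta> e2) + (k + h) * Re (\<beta> f2)) = Re (snd (P e1 e2 f2))"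
      "a * ((k + h) * Im (\<beta> e2) + (k - h) * Re (\<beta> f2)) = Im (snd (P f1 e2 f2))"
      "a * ((k - h) * Im (\<beta> f2) - (k + h) * Re (\<beta> e2)) = Im (snd (P e1 e2 f2))"
      "a * ((k - h) * Re (\<beta> e2) - (k + h) * Im (\<beta> f2)) = Re (snd (P f1 e2 f2))"
      unfolding P_def by (simp_all only: ev, simp_all add: algebra_simps)
    then show
      "a * ((h - k) * \<delta> f2 - 2 * h * Re (\<beta> e1)) = 0"
      "a * ((k - h) * \<delta> f2 - 2 * h * Im (\<beta> f1)) = 0"
      "a * ((k - h) * (Re (\<beta> e1) - Im (\<beta> f1)) - 4 * h * a * (k + h)) = 0"
      "a * ((k - h) * (Re (\<beta> e1) - Im (\<beta> f1)) + 2 * h * \<delta> f2) = 0"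
      "a * ((k - h) * Im (\<beta> e2) + (k + h) * Re (\<beta> f2)) = 0"
      "a * ((k + h) * Im (\<beta> e2) + (k - h) * Re (\<beta> f2)) = 0"
      "a * ((k - h) * Im (\<beta> f2) - (k + h) * Re (\<beta> e2)) = 0"
      "a * ((k - h) * Re (\<beta> e2) - (k + h) * Im (\<beta> f2)) = 0"
      unfolding P by simp_all
  qed
  have s_eq: "s = 2 * h" "c = k + h" by (simp_all add: c_def k_def h_def)
  \<comment> \<open>Within each of the pairs 5, 6 and 7, 8, sum and difference separate
    \<open>h\<close> from \<open>k\<close>. The combinations with factor \<open>2 * h = s\<close>
    come first; those with factor \<open>k\<close> then annihilate
    \<open>\<beta> e2\<close>.\<close>
  have "s * (Re (\<beta> f2) - Im (\<beta> e2)) = 0" "s * (Re (\<beta> e2) + Im (\<beta> f2)) = 0"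
    using eqs(5-8) a unfolding s_eq by (simp_all only: mult_eq_0_iff, algebra+)
  then have 1: "Re (\<beta> f2) = Im (\<beta> e2)" "Im (\<beta> f2) = - Re (\<beta> e2)" using s by auto
  have 2: "k * Im (\<beta> e2) = 0" "k * Re (\<beta> e2) = 0"
    using eqs(5-8) a unfolding 1 by (simp_all only: mult_eq_0_iff, algebra+)
  have 3: "s * (\<delta> f2 + 2 * a * c) = 0" using eqs(3,4) a unfolding s_eq by (simp only: mult_eq_0_iff, algebra)
  then have d: "\<delta> f2 = - 2 * a * c" using s by simp
  \<comment> \<open>For \<open>k = 0\<close> equations 1 and 2 give
    \<open>Re (\<beta> e1) - Im (\<beta> f1) = - a\<close>, whereas equation 3 demands
    \<open>- 2 * a\<close>.\<close>
  have "k \<noteq> 0"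
  proof
    assume "k = 0"
    then have v: "h = 1/2" "c = 1/2" "\<delta> f2 = - a" using d by (simp_all add: k_def h_def c_def)
    have x: "Re (\<beta> e1) = - a / 2" using eqs(1) a unfolding v \<open>k = 0\<close> mult_eq_0_iff by simp
    have y: "Im (\<beta> f1) = a / 2" using eqs(2) a unfolding v \<open>k = 0\<close> mult_eq_0_iff by simp
    have "- ((Re (\<beta> e1) - Im (\<beta> f1)) / 2) = a" using eqs(3) a unfolding v \<open>k = 0\<close> mult_eq_0_iff by simp
    then have "a = 0" unfolding x y by (simp add: field_simps)
    then show False using a by simp
  qed
  then have b: "\<beta> e2 = 0" "\<beta> f2 = 0" using 1 2 by (simp_all add: complex_eq_iff)
  have \<delta>: "\<delta> x = Im (snd (D x (0,1)))" for x by (simp add: M)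
  \<comment> \<open>The torsion drops out: \<open>e2\<close> and \<open>f2\<close> are complex
    proportional, so \<open>cdet\<close> vanishes, and both are orthogonal to
    \<open>(a, 0)\<close>.\<close>
  have "br e2 f2 = (- \<delta> e2) *\<^sub>R e2 + (- \<delta> f2) *\<^sub>R f2"
    unfolding br M b by (simp add: ev prod_eq_iff complex_eq_iff)
  then have "\<delta> (br e2 f2) = - \<delta> e2 * \<delta> e2 - \<delta> f2 * \<delta> f2"
    unfolding \<delta> by (simp add: D(1,3) del: scaleR_minus_left)
  \<comment> \<open>\<open>D e2\<close> and \<open>D f2\<close> are diagonal, hence commute; by
    flatness the connection matrix along \<open>br e2 f2\<close> vanishes on
    \<open>(0, 1)\<close>.\<close>
  moreover have "\<delta> (br e2 f2) = 0"
    using flat[of e2 f2 "(0,1)"] unfolding M b by (simp add: complex_eq_iff)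
  ultimately have "\<delta> f2 = 0" by (smt (verit) mult_eq_0_iff zero_le_square minus_mult_left)
  then show False using d a s by (simp add: c_def)
qed

text \<open>The normal form costs nothing: SU(2) moves any vector of C^2 to a real multiple of
  \<open>(1, 0)\<close> and preserves \<open>cdet\<close>, \<open>herm\<close> and
  \<open>csig\<close>, from which \<open>tors\<close> is built.\<close>

theorem flat_imp_torsion_zero:
  fixes w :: "complex \<times> complex" and s :: real
  assumes D: "\<And>x y z. D (x + y) z = D x z + D y z" "\<And>x y z. D x (y + z) = D x y + D x z"
      "\<And>r x y. D (r *\<^sub>R x) y = r *\<^sub>R D x y"
      "\<And>c x y. D x (cmul c y) = cmul c (D x y)" "\<And>x y z. herm (D x y) z + herm y (D x z) = 0"
    and br: "\<And>x y. br x y = D x y - D y x - tors s w x y"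
    and flat: "\<And>x y z. D (br x y) z = D x (D y z) - D y (D x z)"
    and jac: "\<And>x y z. br x (br y z) + br y (br z x) + br z (br x y) = 0"
    and s: "s \<noteq> 0" "s \<noteq> 2"
  shows "w = 0"
proof (rule ccontr)
  assume "w \<noteq> 0"
  define a where "a = norm w"
  define v where "v = inverse a *\<^sub>R w"
  have a: "a \<noteq> 0" using \<open>w \<noteq> 0\<close> by (simp add: a_def)
  have w: "w = a *\<^sub>R v" using a by (simp add: v_def)
  have "norm v = 1" using a by (simp add: v_def a_def)
  then have "(norm (fst v))\<^sup>2 + (norm (snd v))\<^sup>2 = 1"
    by (simp add: norm_Pair norm_prod_def)
  then have v: "fst v * cnj (fst v) + snd v * cnj (snd v) = 1"
    by (metis complex_norm_square of_real_add of_real_1)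
  \<comment> \<open>\<open>U\<close> lies in \<open>SU(2)\<close>, hence it commutes with \<^const>\<open>csig\<close>; it maps \<open>(a, 0)\<close> to \<open>w\<close>.\<close>
  define U where "U y = cmul (fst y) v + cmul (snd y) (csig v)" for y
  define V where "V z = (herm z v, herm z (csig v))" for z
  have UV: "U (V z) = z" for z
  proof -
    have "fst (U (V z)) = fst z * (fst v * cnj (fst v) + snd v * cnj (snd v))"
      "snd (U (V z)) = snd z * (fst v * cnj (fst v) + snd v * cnj (snd v))"
      by (simp_all add: U_def V_def alg_defs algebra_simps)
    then show ?thesis by (simp add: v prod_eq_iff)
  qed
  have VU: "V (U y) = y" for y
  proof -
    have "fst (V (U y)) = fst y * (fst v * cnj (fst v) + snd v * cnj (snd v))"
      "snd (V (U y)) = snd y * (fst v * cnj (fst v) + snd v * cnj (snd v))"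
      by (simp_all add: U_def V_def alg_defs algebra_simps)
    then show ?thesis by (simp add: v prod_eq_iff)
  qed
  have U: "U (x + y) = U x + U y" "U (r *\<^sub>R x) = r *\<^sub>R U x" "U (cmul c x) = cmul c (U x)"
    "U (x - y) = U x - U y" for x y r c
    by (simp_all add: U_def alg_defs algebra_simps prod_eq_iff)
  have V: "V (x + y) = V x + V y" "V (r *\<^sub>R x) = r *\<^sub>R V x" "V (cmul c x) = cmul c (V x)"
    "V (x - y) = V x - V y" "V 0 = 0" for x y r c
    by (simp_all add: V_def alg_defs algebra_simps prod_eq_iff)
  have hU: "herm (U x) (U y) = herm x y" for x y
  proof -
    have "herm (U x) (U y) = herm x y * (fst v * cnj (fst v) + snd v * cnj (snd v))"
      by (simp add: U_def alg_defs algebra_simps)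
    then show ?thesis by (simp add: v)
  qed
  have dU: "cdet (U x) (U y) = cdet x y" for x y
  proof -
    have "cdet (U x) (U y) = cdet x y * (fst v * cnj (fst v) + snd v * cnj (snd v))"
      by (simp add: U_def alg_defs algebra_simps)
    then show ?thesis by (simp add: v)
  qed
  have sU: "csig (U x) = U (csig x)" for x by (simp add: U_def alg_defs)
  have wU: "w = U (of_real a, 0)" unfolding w by (simp add: U_def alg_defs prod_eq_iff scaleR_conv_of_real)
  have tU: "tors s w (U x) (U y) = U (tors s (of_real a, 0) x y)" for x y
    unfolding tors_def wU hU dU sU by (simp add: U)
  have hV: "herm (V x) y = herm x (U y)" "herm y (V x) = herm (U y) x" for x y
    by (metis UV hU)+
  define D' where "D' x y = V (D (U x) (U y))" for x y
  define br' where "br' x y = V (br (U x) (U y))" for x y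
  have "a = 0"
  proof (rule flat_imp_torsion_zero_normalized[of D' br' s a])
    show "br' x y = D' x y - D' y x - tors s (complex_of_real a, 0) x y" for x y
      by (simp add: br'_def D'_def br tU V VU)
    show "D' (br' x y) z = D' x (D' y z) - D' y (D' x z)" for x y z
      by (simp add: br'_def D'_def UV flat V)
    show "br' x (br' y z) + br' y (br' z x) + br' z (br' x y) = 0" for x y z
      by (simp add: br'_def UV jac V flip: V(1))
  qed (simp_all add: D'_def U V D hV s)
  then show False using a by simp
qed

section \<open>Unitary frames and uniqueness of connections on C^2\<close>

lemma cmul_simps:
  "cmul c (x + y) = cmul c x + cmul c y" "cmul c (x - y) = cmul c x - cmul c y"
  "cmul c (- x) = - cmul c x" "cmul c (r *\<^sub>R x) = r *\<^sub>R cmul c x"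
  "cmul c (cmul d x) = cmul (c * d) x" "cmul (c + d) x = cmul c x + cmul d x"
  "cmul (- c) x = - cmul c x" "cmul 1 x = x" "cmul c 0 = 0"
  by (simp_all add: cmul_def prod_eq_iff algebra_simps)

lemma herm_cmul_left: "herm (cmul c x) y = c * herm x y"
  by (simp add: herm_def cmul_def algebra_simps)

lemma herm_cmul_right: "herm x (cmul c y) = cnj c * herm x y"
  by (simp add: herm_def cmul_def algebra_simps)

lemma herm_add: "herm (x + y) z = herm x z + herm y z" "herm z (x + y) = herm z x + herm z y"
  "herm (x - y) z = herm x z - herm y z" "herm z (x - y) = herm z x - herm z y"
  "herm (- x) z = - herm x z" "herm z (- x) = - herm z x"
  by (simp_all add: herm_def algebra_simps)

lemma Re_herm_commute: "Re (herm x y) = Re (herm y x)"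
  by (simp add: herm_def)

lemma Re_herm_self_eq_0: "Re (herm x x) = 0 \<longleftrightarrow> x = 0"
  by (simp add: herm_def complex_eq_iff prod_eq_iff add_nonneg_eq_0_iff)

lemma Re_herm_nondegenerate: "(\<And>z. Re (herm x z) = 0) \<Longrightarrow> x = 0"
  using Re_herm_self_eq_0 by blast

text \<open>Gram-Schmidt for complex lines: \<open>v\<close> and \<open>J v\<close> span at most a
  plane, so a unit vector \<open>u\<close> orthogonal to both exists in dimension 4, and
  \<open>J u\<close> is then orthogonal to all three because J is an isometry with square
  -1.\<close>

lemma hermitian_frame:
  fixes G :: "'e::euclidean_space \<Rightarrow> 'e \<Rightarrow> real" and J :: "'e \<Rightarrow> 'e"
  assumes dim: "DIM('e) = 4"
    and G: "\<And>x y z. G (x + y) z = G x z + G y z" "\<And>r x y. G (r *\<^sub>R x) y = r * G x y"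
      "\<And>x y. G x y = G y x" "\<And>x. x \<noteq> 0 \<Longrightarrow> G x x > 0"
    and J: "linear J" "\<And>x. J (J x) = - x" "\<And>x y. G (J x) (J y) = G x y"
  obtains f :: "complex \<times> complex \<Rightarrow> 'e"
  where "linear f" "surj f" "\<And>x. f (cmul \<i> x) = J (f x)" "\<And>x y. G (f x) (f y) = Re (herm x y)"
proof -
  have Gr: "G z (x + y) = G z x + G z y" "G y (r *\<^sub>R x) = r * G y x" for x y z r
    using G(1-3) by metis+
  have Gm: "G (- x) y = - G x y" "G x (- y) = - G x y" for x y
    using G(2)[of "-1" x y] Gr(2)[of x "-1" y] by simp_all
  have Gd: "G (x - y) z = G x z - G y z" for x y z
    using G(1)[of x "- y" z] by (simp add: Gm)
  have GJ: "G x (J x) = 0" for x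
    using J(3)[of x "J x"] G(3)[of "J x" x] by (simp add: J(2) Gm)
  have GJ': "G (J x) y = - G x (J y)" for x y
    using J(3)[of x "J y"] by (simp add: J(2) Gm)
  have unit: "\<exists>r. G (r *\<^sub>R x) (r *\<^sub>R x) = 1" if "x \<noteq> 0" for x
    using G(4)[OF that] by (intro exI[of _ "1 / sqrt (G x x)"]) (simp add: G(2) Gr(2))
  obtain b :: 'e where "b \<in> Basis" using nonempty_Basis by blast
  then obtain r where r: "G (r *\<^sub>R b) (r *\<^sub>R b) = 1" using unit nonzero_Basis by blast
  define v where "v = r *\<^sub>R b"
  have v: "G v v = 1" using r by (simp add: v_def)
  have "span {v, J v} \<noteq> UNIV"
  proof
    assume "span {v, J v} = UNIV"
    then have "dim (UNIV :: 'e set) \<le> card {v, J v}" by (intro dim_le_card) auto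
    also have "\<dots> \<le> 2" by (simp add: card_insert_if)
    finally show False using dim by simp
  qed
  then obtain z where z: "z \<notin> span {v, J v}" by blast
  define y where "y = z - G z v *\<^sub>R v - G z (J v) *\<^sub>R J v"
  have "y \<noteq> 0"
  proof
    assume "y = 0"
    then have "z = G z v *\<^sub>R v + G z (J v) *\<^sub>R J v" by (simp add: y_def algebra_simps)
    moreover have "G z v *\<^sub>R v + G z (J v) *\<^sub>R J v \<in> span {v, J v}"
      by (intro span_add span_scale span_base) auto
    ultimately show False using z by simp
  qed
  then obtain q where q: "G (q *\<^sub>R y) (q *\<^sub>R y) = 1" using unit by blast
  define u where "u = q *\<^sub>R y"
  have "G y v = 0" "G y (J v) = 0"
    unfolding y_def Gd G(2) using v J(3)[of v v] GJ[of v] G(3)[of "J v" v] by simp_all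
  then have u: "G u u = 1" "G u v = 0" "G u (J v) = 0" using q by (simp_all add: u_def G(2))
  define f where "f x = Re (fst x) *\<^sub>R v + Im (fst x) *\<^sub>R J v + Re (snd x) *\<^sub>R u + Im (snd x) *\<^sub>R J u" for x :: "complex \<times> complex"
  have lin: "linear f" by (rule linearI) (simp_all add: f_def algebra_simps)
  have fi: "f (cmul \<i> x) = J (f x)" for x
    by (simp add: f_def cmul_def linear_add[OF J(1)] linear_cmul[OF J(1)] J(2))
  have "G v u = 0" "G v (J u) = 0" "G (J v) u = 0" "G (J v) (J u) = 0" "G (J u) v = 0" "G (J u) (J v) = 0"
     "G u (J u) = 0" "G (J u) u = 0" "G v (J v) = 0" "G (J v) v = 0" "G (J v) (J v) = 1" "G (J u) (J u) = 1"
    using u v GJ GJ' G(3) J by (metis minus_zero)+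
  then have Gf: "G (f x) (f y) = Re (herm x y)" for x y
    by (simp add: f_def G(1,2) Gr u v herm_def)
  have "inj f"
  proof (rule linear_injective_0[OF lin, THEN iffD2], intro allI impI)
    fix x assume "f x = 0"
    moreover have "G 0 0 = 0" using G(2)[of 0 0 0] by simp
    ultimately show "x = 0" using Gf[of x x] Re_herm_self_eq_0 by simp
  qed
  \<comment> \<open>Both sides have real dimension 4, so the injective linear map is onto.\<close>
  then have "dim (range f) = dim (UNIV :: (complex \<times> complex) set)"
    by (intro dim_image_eq[OF lin]) (auto intro: inj_on_subset)
  then have "span (range f) = UNIV" by (subst dim_eq_full[symmetric]) (simp add: dim)
  then have "surj f" using linear_subspace_image[OF lin subspace_UNIV] by (metis span_eq_iff)
  from that[OF lin this fi Gf] show thesis .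
qed

text \<open>E is the difference of two Chern connections. Twice its (0,1)-part in \<open>x\<close>,
  called F below, is symmetric by the torsion condition; being antilinear in one argument and linear
  in the other, it vanishes. So E is complex linear in \<open>x\<close>, and then
  \<open>E (cmul \<i> x)\<close> is both skew-Hermitian and \<open>\<i>\<close> times a
  skew-Hermitian map, hence zero.\<close>

lemma chern_difference_zero:
  fixes E :: "complex \<times> complex \<Rightarrow> complex \<times> complex \<Rightarrow> complex \<times> complex"
  assumes m: "\<And>x y. E (- x) y = - E x y" and i: "\<And>x y. E x (cmul \<i> y) = cmul \<i> (E x y)"
    and skew: "\<And>x y z. Re (herm (E x y) z) + Re (herm y (E x z)) = 0"
    and tor: "\<And>x y. E x y - E y x + (E (cmul \<i> x) (cmul \<i> y) - E (cmul \<i> y) (cmul \<i> x)) = 0"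
  shows "E x y = 0"
proof -
  have ii: "cmul \<i> (cmul \<i> x) = - x" for x by (simp add: cmul_simps)
  define F where "F x y = E x y + cmul \<i> (E (cmul \<i> x) y)" for x y
  have sym: "F x y = F y x" for x y using tor[of x y] by (simp add: F_def i algebra_simps)
  have "F (cmul \<i> x) y = - cmul \<i> (F x y)" for x y by (simp add: F_def ii m cmul_simps)
  moreover have "F x (cmul \<i> y) = cmul \<i> (F x y)" for x y by (simp add: F_def i cmul_simps)
  ultimately have "cmul \<i> (F x y) = - cmul \<i> (F x y)" for x y using sym by metis
  then have "F x y = 0" for x y by (simp add: cmul_def prod_eq_iff complex_eq_iff)
  then have "cmul \<i> (E x y + cmul \<i> (E (cmul \<i> x) y)) = 0" for x y by (simp add: F_def cmul_simps)
  then have J: "E (cmul \<i> x) y = cmul \<i> (E x y)" for x y by (simp add: cmul_simps algebra_simps)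
  have "Re (herm (cmul \<i> (E x y)) z) = 0" for z
    using skew[of "cmul \<i> x" y z] skew[of x "y" "z"] skew[of x "cmul \<i> y" z]
    by (simp add: J i herm_cmul_left herm_cmul_right)
  then have "cmul \<i> (E x y) = 0" by (rule Re_herm_nondegenerate)
  then show ?thesis by (simp add: cmul_def prod_eq_iff)
qed

text \<open>E is the difference of two Bismut connections, so \<open>e\<close> is a 3-form.
  Inserting \<open>\<i>\<close> into the last two arguments leaves \<open>e\<close> unchanged, by
  skewness then also into any other two. Therefore an insertion into one argument equals the
  insertion into all three, whichever argument it is; yet insertions into the second and third
  differ by a sign.\<close>

lemma bismut_difference_zero:
  fixes E :: "complex \<times> complex \<Rightarrow> complex \<times> complex \<Rightarrow> complex \<times> complex"
  assumes i: "\<And>x y. E x (cmul \<i> y) = cmul \<i> (E x y)"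
    and skew: "\<And>x y z. Re (herm (E x y) z) + Re (herm y (E x z)) = 0"
    and tor: "\<And>x y z. Re (herm (E x y - E y x) z) = - Re (herm (E x z - E z x) y)"
  shows "E x y = 0"
proof -
  define e where "e x y z = Re (herm (E x y) z)" for x y z
  have e23: "e x y z = - e x z y" for x y z
    using skew[of x y z] Re_herm_commute[of y "E x z"] by (simp add: e_def)
  have e13: "e x y z = - e z y x" for x y z
    using tor[of y x z] e23[of y x z] e23[of z y x] by (simp add: e_def herm_add)
  have e12: "e x y z = - e y x z" for x y z by (metis e13 e23)
  have eii: "e x (cmul \<i> y) (cmul \<i> z) = e x y z" for x y z
    by (simp add: e_def i herm_cmul_left herm_cmul_right)
  have eii12: "e (cmul \<i> x) (cmul \<i> y) z = e x y z" for x y z using eii[of z x y] e13 e12 e23 by metis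
  have eii13: "e (cmul \<i> x) y (cmul \<i> z) = e x y z" for x y z using eii[of y x z] e12 by metis
  have "e x (cmul \<i> y) z = - e x y (cmul \<i> z)" for x y z
    by (simp add: e_def i herm_cmul_left herm_cmul_right)
  moreover have "e x y (cmul \<i> z) = e (cmul \<i> x) y z" for x y z by (metis eii eii12)
  moreover have "e x (cmul \<i> y) z = e (cmul \<i> x) y z" for x y z by (metis eii eii13)
  ultimately have "e x y (cmul \<i> z) = 0" for z by (metis equal_neg_zero)
  then have "e x y (cmul \<i> (cmul (- \<i>) z)) = 0" for z .
  then have "Re (herm (E x y) z) = 0" for z by (simp add: e_def cmul_simps)
  then show ?thesis by (rule Re_herm_nondegenerate)
qed

text \<open>Coefficients of a Hermitian connection in a left invariant unitary frame. Complex
  linearity in the second argument is the parallelism of J; skewness is that of g, since inner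
  products of frame fields are constant. In the direction \<open>x\<close> a connection is real
  linear only.\<close>

definition unitary_coeff :: "(complex \<times> complex \<Rightarrow> complex \<times> complex \<Rightarrow> complex \<times> complex) \<Rightarrow> bool" where
  "unitary_coeff \<Gamma> \<longleftrightarrow>
     (\<forall>x y z. \<Gamma> (x + y) z = \<Gamma> x z + \<Gamma> y z \<and> \<Gamma> x (y + z) = \<Gamma> x y + \<Gamma> x z) \<and>
     (\<forall>r x y. \<Gamma> (r *\<^sub>R x) y = r *\<^sub>R \<Gamma> x y \<and> \<Gamma> x (r *\<^sub>R y) = r *\<^sub>R \<Gamma> x y) \<and>
     (\<forall>x y. \<Gamma> x (cmul \<i> y) = cmul \<i> (\<Gamma> x y)) \<and>
     (\<forall>x y z. Re (herm (\<Gamma> x y) z) + Re (herm y (\<Gamma> x z)) = 0)"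

lemma unitary_coeffD:
  assumes "unitary_coeff \<Gamma>"
  shows "\<Gamma> (x + y) z = \<Gamma> x z + \<Gamma> y z" "\<Gamma> x (y + z) = \<Gamma> x y + \<Gamma> x z"
    "\<Gamma> (r *\<^sub>R x) y = r *\<^sub>R \<Gamma> x y" "\<Gamma> x (r *\<^sub>R y) = r *\<^sub>R \<Gamma> x y"
    "\<Gamma> x (cmul \<i> y) = cmul \<i> (\<Gamma> x y)" "Re (herm (\<Gamma> x y) z) + Re (herm y (\<Gamma> x z)) = 0"
    "\<Gamma> (- x) y = - \<Gamma> x y" "\<Gamma> x (- y) = - \<Gamma> x y"
proof -
  show *: "\<Gamma> (r *\<^sub>R x) y = r *\<^sub>R \<Gamma> x y" "\<Gamma> x (r *\<^sub>R y) = r *\<^sub>R \<Gamma> x y" for r x y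
    using assms unfolding unitary_coeff_def by blast+
  show "\<Gamma> (- x) y = - \<Gamma> x y" "\<Gamma> x (- y) = - \<Gamma> x y"
    using *(1)[of "-1" x y] *(2)[of x "-1" y] by simp_all
qed (use assms in \<open>unfold unitary_coeff_def, blast+\<close>)

lemma cmul_eq_real_combination: "cmul c x = Re c *\<^sub>R x + Im c *\<^sub>R cmul \<i> x"
  by (simp add: cmul_def prod_eq_iff complex_eq_iff)

lemma unitary_coeff_cmul:
  assumes "unitary_coeff \<Gamma>"
  shows "\<Gamma> x (cmul c y) = cmul c (\<Gamma> x y)"
  unfolding cmul_eq_real_combination[of c] unitary_coeffD[OF assms] ..

lemma unitary_coeff_herm:
  assumes "unitary_coeff \<Gamma>"
  shows "herm (\<Gamma> x y) z + herm y (\<Gamma> x z) = 0"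
proof -
  have "Re (herm (\<Gamma> x y) z + herm y (\<Gamma> x z)) = 0" using unitary_coeffD(6)[OF assms] by simp
  moreover have "Im (herm (\<Gamma> x y) z + herm y (\<Gamma> x z)) = 0"
    \<comment> \<open>Replacing \<open>z\<close> by \<open>cmul \<i> z\<close> turns the imaginary
      part of the Hermitian product into a real part.\<close>
    using unitary_coeffD(6)[OF assms, of x y "cmul \<i> z"]
    by (simp add: unitary_coeffD(5)[OF assms] herm_cmul_right)
  ultimately show ?thesis by (simp only: complex_eq_iff zero_complex.sel)
qed

text \<open>\<open>cdet\<close> spans the alternating complex bilinear forms on C^2, so the value on
  the standard basis determines T.\<close>

lemma complex_bilinear_alternating:
  fixes T :: "complex \<times> complex \<Rightarrow> complex \<times> complex \<Rightarrow> complex \<times> complex"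
  assumes add: "\<And>x y z. T (x + y) z = T x z + T y z" and cm: "\<And>c x y. T (cmul c x) y = cmul c (T x y)"
    and alt: "\<And>x y. T x y = - T y x"
  shows "T x y = cmul (cdet x y) (T (1, 0) (0, 1))"
proof -
  define e1 :: "complex \<times> complex" where "e1 = (1, 0)"
  define e2 :: "complex \<times> complex" where "e2 = (0, 1)"
  have dec: "x = cmul (fst x) e1 + cmul (snd x) e2" for x by (simp add: e1_def e2_def cmul_def)
  have add': "T z (x + y) = T z x + T z y" and cm': "T y (cmul c x) = cmul c (T y x)" for x y z c
    using alt add cm by (metis minus_add_distrib, metis cmul_simps(3))
  have 0: "T z z = 0" for z using alt[of z z] by (simp add: eq_neg_iff_add_eq_0 prod_eq_iff)
  have "T x y = T (cmul (fst x) e1 + cmul (snd x) e2) (cmul (fst y) e1 + cmul (snd y) e2)"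
    using dec by metis
  also have "\<dots> = cmul (fst x * snd y) (T e1 e2) + cmul (snd x * fst y) (T e2 e1)"
    by (simp add: add add' cm cm' 0 cmul_simps mult.commute)
  also have "\<dots> = cmul (cdet x y) (T e1 e2)"
    unfolding alt[of e2 e1] by (simp add: cmul_def cdet_def prod_eq_iff algebra_simps)
  finally show ?thesis by (simp add: e1_def e2_def)
qed

text \<open>The Bismut minus the Chern connection if the Chern torsion is \<open>cdet x y\<close> times \<open>w\<close>.\<close>

definition gauduchon_shift :: "complex \<times> complex \<Rightarrow> complex \<times> complex \<Rightarrow> complex \<times> complex \<Rightarrow> complex \<times> complex" where
  "gauduchon_shift w x y = cmul (herm y w) (csig x) - cmul (cdet x y) w"

lemma unitary_coeff_add_shift:
  assumes "unitary_coeff \<Gamma>"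
  shows "unitary_coeff (\<lambda>x y. \<Gamma> x y + r *\<^sub>R gauduchon_shift w x y)"
proof -
  have s: "gauduchon_shift w (x + y) z = gauduchon_shift w x z + gauduchon_shift w y z"
    "gauduchon_shift w x (y + z) = gauduchon_shift w x y + gauduchon_shift w x z"
    "gauduchon_shift w (r *\<^sub>R x) y = r *\<^sub>R gauduchon_shift w x y"
    "gauduchon_shift w x (r *\<^sub>R y) = r *\<^sub>R gauduchon_shift w x y"
    "gauduchon_shift w x (cmul \<i> y) = cmul \<i> (gauduchon_shift w x y)" for x y z r
    by (simp_all add: gauduchon_shift_def alg_defs prod_eq_iff scaleR_conv_of_real algebra_simps)
  \<comment> \<open>The shift is the adjoint of \<open>y \<mapsto> cdet x y w\<close> minus that
    map, hence skew-Hermitian.\<close>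
  have "herm (gauduchon_shift w x y) z + herm y (gauduchon_shift w x z) = 0" for x y z
    by (simp add: gauduchon_shift_def alg_defs algebra_simps)
  then have k: "Re (herm (gauduchon_shift w x y) z) + Re (herm y (gauduchon_shift w x z)) = 0" for x y z
    by (metis plus_complex.sel(1) zero_complex.sel(1))
  have h: "Re (herm (r *\<^sub>R x) y) = r * Re (herm x y)" "Re (herm x (r *\<^sub>R y)) = r * Re (herm x y)" for x y r
    by (simp_all add: herm_def algebra_simps)
  have sk: "Re (herm (\<Gamma> x y + r *\<^sub>R gauduchon_shift w x y) z) + Re (herm y (\<Gamma> x z + r *\<^sub>R gauduchon_shift w x z)) = 0" for x y z
  proof -
    have "Re (herm (\<Gamma> x y + r *\<^sub>R gauduchon_shift w x y) z) + Re (herm y (\<Gamma> x z + r *\<^sub>R gauduchon_shift w x z))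
      = (Re (herm (\<Gamma> x y) z) + Re (herm y (\<Gamma> x z)))
        + r * (Re (herm (gauduchon_shift w x y) z) + Re (herm y (gauduchon_shift w x z)))"
      by (simp add: herm_add h algebra_simps)
    then show ?thesis using unitary_coeffD(6)[OF assms, of x y z] k[of x y z] by simp
  qed
  show ?thesis
    unfolding unitary_coeff_def
    by (intro conjI allI; (rule sk)?)
      (simp_all add: unitary_coeffD(1-5)[OF assms] s cmul_simps algebra_simps)
qed

text \<open>The pairing with \<open>z\<close> is minus the real part of the cyclic sum of
  \<open>cdet x y * cnj (herm z w)\<close>, an alternating expression.\<close>

lemma Re_herm_bismut_torsion_skew:
  "Re (herm (cmul (cdet x y) w + gauduchon_shift w x y - gauduchon_shift w y x) z)
    = - Re (herm (cmul (cdet x z) w + gauduchon_shift w x z - gauduchon_shift w z x) y)"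
  by (simp add: gauduchon_shift_def alg_defs algebra_simps)

text \<open>The model of the Lie algebra is \<open>\<complex>\<^sup>2\<close> with the bracket \<open>br\<close>; \<open>C\<close> and \<open>B\<close> are the coefficients
  of the Chern and Bismut connections in a left invariant unitary frame.\<close>

theorem flat_gauduchon_imp_chern_torsion_zero:
  assumes C: "unitary_coeff C" and B: "unitary_coeff B"
    and br_add: "\<And>x y z. br (x + y) z = br x z + br y z"
    and br_scale: "\<And>r x y. br (r *\<^sub>R x) y = r *\<^sub>R br x y"
    and br_alt: "\<And>x y. br x y = - br y x"
    and chern: "\<And>x y. (C x y - C y x - br x y) + (C (cmul \<i> x) (cmul \<i> y) - C (cmul \<i> y) (cmul \<i> x) - br (cmul \<i> x) (cmul \<i> y)) = 0"
    and bismut: "\<And>x y z. Re (herm (B x y - B y x - br x y) z) = - Re (herm (B x z - B z x - br x z) y)"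
    and nij: "\<And>x y. br x y + cmul \<i> (br (cmul \<i> x) y) + cmul \<i> (br x (cmul \<i> y)) - br (cmul \<i> x) (cmul \<i> y) = 0"
    and jac: "\<And>x y z. br x (br y z) + br y (br z x) + br z (br x y) = 0"
    and flat: "\<And>x y z. D (br x y) z = D x (D y z) - D y (D x z)"
    and D: "\<And>x y. D x y = (1 - s / 2) *\<^sub>R C x y + (s / 2) *\<^sub>R B x y"
    and s: "s \<noteq> 0" "s \<noteq> 2"
  shows "br x y = C x y - C y x"
proof -
  define T where "T x y = C x y - C y x - br x y" for x y
  define w where "w = T (1, 0) (0, 1)"
  note Cs = unitary_coeffD[OF C] unitary_coeff_cmul[OF C]
  have ii: "cmul \<i> (cmul \<i> x) = - x" for x by (simp add: cmul_simps)
  have T_add: "T (x + y) z = T x z + T y z" for x y z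
    unfolding T_def br_add by (simp add: Cs)
  have T_scale: "T (r *\<^sub>R x) y = r *\<^sub>R T x y" for x y r
    unfolding T_def br_scale by (simp add: Cs algebra_simps)
  have T_alt: "T x y = - T y x" for x y
    unfolding T_def using br_alt[of x y] by simp
  have T_minus: "T x (- y) = - T x y" for x y
    using T_scale[of "-1" y x] T_alt[of x y] T_alt[of x "- y"] by simp
  have T11: "T (cmul \<i> x) (cmul \<i> y) = - T x y" for x y
    using chern[of x y] unfolding T_def[symmetric] by (simp add: add_eq_0_iff)
  have T_i': "T x (cmul \<i> y) = T (cmul \<i> x) y" for x y
    using T11[of x "cmul \<i> y"] by (simp add: ii T_minus)
  have br: "br x y = C x y - C y x - T x y" for x y by (simp add: T_def)
  \<comment> \<open>In the Nijenhuis tensor all terms with \<open>C\<close> cancel, because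
    \<open>C\<close> commutes with \<open>\<i>\<close>. The rest is an identity for T, which
    together with the vanishing of the (1,1)-part makes T complex linear.\<close>
  have "T x y + cmul \<i> (T (cmul \<i> x) y) = 0" for x y
  proof -
    have "T x y + cmul \<i> (T (cmul \<i> x) y) + cmul \<i> (T x (cmul \<i> y)) - T (cmul \<i> x) (cmul \<i> y) = 0"
      using nij[of x y] unfolding br by (simp add: Cs ii cmul_simps algebra_simps)
    then have "2 *\<^sub>R (T x y + cmul \<i> (T (cmul \<i> x) y)) = 0"
      by (simp add: T11 T_i'[of x y] scaleR_2 algebra_simps)
    then show ?thesis by simp
  qed
  then have "cmul \<i> (T x y + cmul \<i> (T (cmul \<i> x) y)) = 0" for x y by (simp add: cmul_simps)
  then have T_i: "T (cmul \<i> x) y = cmul \<i> (T x y)" for x y by (simp add: cmul_simps algebra_simps)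
  have "T (cmul c x) y = cmul c (T x y)" for c x y
    unfolding cmul_eq_real_combination[of c] T_add T_scale T_i ..
  then have T: "T x y = cmul (cdet x y) w" for x y
    unfolding w_def by (rule complex_bilinear_alternating[OF T_add _ T_alt])
  \<comment> \<open>The candidate for the Bismut connection; uniqueness identifies it with
    \<open>B\<close>.\<close>
  define K where "K x y = C x y + 1 *\<^sub>R gauduchon_shift w x y" for x y
  have "unitary_coeff K" unfolding K_def by (rule unitary_coeff_add_shift[OF C])
  note Ks = unitary_coeffD[OF this]
  have tK: "K x y - K y x - br x y = cmul (cdet x y) w + gauduchon_shift w x y - gauduchon_shift w y x" for x y
    unfolding br T K_def by simp
  have BK: "B x y - K x y = 0" for x y
  proof (rule bismut_difference_zero[of "\<lambda>x y. B x y - K x y"])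
    show "B x (cmul \<i> y) - K x (cmul \<i> y) = cmul \<i> (B x y - K x y)" for x y
      by (simp add: Ks unitary_coeffD[OF B] cmul_simps)
    show "Re (herm (B x y - K x y) z) + Re (herm y (B x z - K x z)) = 0" for x y z
      using Ks(6)[of x y z] unitary_coeffD(6)[OF B, of x y z] by (simp add: herm_add)
    fix x y z
    have e: "B x y - K x y - (B y x - K y x) = (B x y - B y x - br x y) - (K x y - K y x - br x y)" for x y
      by simp
    show "Re (herm (B x y - K x y - (B y x - K y x)) z) = - Re (herm (B x z - K x z - (B z x - K z x)) y)"
      using bismut[of x y z] Re_herm_bismut_torsion_skew[of x y w z]
      unfolding e tK by (simp add: herm_add)
  qed
  have D': "D x y = C x y + (s / 2) *\<^sub>R gauduchon_shift w x y" for x y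
    using BK[of x y] unfolding D K_def by (simp add: prod_eq_iff algebra_simps)
  have Du: "unitary_coeff D"
    using unitary_coeff_add_shift[OF C, of "s / 2" w] unfolding D'[abs_def] .
  have "w = 0"
  proof (rule flat_imp_torsion_zero[of D br s w])
    \<comment> \<open>Antisymmetrizing the shift yields \<open>cdet x y\<close> times
      \<open>w\<close> twice with a minus sign, which turns the coefficient 1 of the Chern torsion
      into \<open>1 - s\<close>.\<close>
    show "br x y = D x y - D y x - tors s w x y" for x y
      unfolding br T D' by (simp add: gauduchon_shift_def tors_def cmul_def prod_eq_iff cdet_def scaleR_conv_of_real field_simps)
    show "herm (D x y) z + herm y (D x z) = 0" for x y z by (rule unitary_coeff_herm[OF Du])
    show "D x (cmul c y) = cmul c (D x y)" for x y c by (rule unitary_coeff_cmul[OF Du])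
  qed (fact unitary_coeffD[OF Du] flat jac s)+
  then show ?thesis unfolding br T by (simp add: cmul_def zero_prod_def)
qed

section \<open>Torsion and the Kaehler condition\<close>

context smooth_manifold
begin

section \<open>Connections, torsion and metric algebra\<close>

lemma affine_connection_field:
  "affine_connection A D \<Longrightarrow> vector_field A X \<Longrightarrow> vector_field A Y \<Longrightarrow> vector_field A (D X Y)"
  unfolding affine_connection_def by blast

lemma affine_connection_add:
  assumes "affine_connection A D" "vector_field A X" "vector_field A Y" "vector_field A Z"
  shows "D (X + Y) Z = D X Z + D Y Z" "D Z (X + Y) = D Z X + D Z Y"
  using assms unfolding affine_connection_def by blast+

lemma affine_connection_fscale:
  assumes "affine_connection A D" "vector_field A X" "vector_field A Y" "smooth_fun_on A UNIV h"
  shows "D (fscale h X) Y = fscale h (D X Y)"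
    "D X (fscale h Y) = fscale (dir_deriv X h) Y + fscale h (D X Y)"
  using assms unfolding affine_connection_def by blast+

lemma torsion_commute: "torsion A D X Y = - torsion A D Y X"
  unfolding torsion_def using lie_bracket_commute[of X Y] by simp

lemma torsion_add_right:
  assumes "affine_connection A D" "vector_field A X" "vector_field A Y" "vector_field A Z"
  shows "torsion A D X (Y + Z) = torsion A D X Y + torsion A D X Z"
  unfolding torsion_def affine_connection_add[OF assms(1,3,4,2)] lie_bracket_add_right[OF assms(2-4)]
  by simp

lemma fscale_diff: "fscale h (X - Y) = fscale h X - fscale h Y"
  by (simp add: fscale_def tscale_def fun_eq_iff algebra_simps)

text \<open>The derivative of \<open>h\<close> produced by the connection cancels the one produced
  by the bracket.\<close>

lemma torsion_fscale_right:
  assumes "affine_connection A D" "vector_field A X" "vector_field A Y" "smooth_fun_on A UNIV h"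
  shows "torsion A D X (fscale h Y) = fscale h (torsion A D X Y)"
  unfolding torsion_def affine_connection_fscale(2)[OF assms] affine_connection_fscale(1)[OF assms(1,3,2,4)]
    lie_bracket_fscale_right[OF assms(2-4)] fscale_diff
  by simp

lemma metric_sym:
  "riemannian_metric A g \<Longrightarrow> u \<in> tangent_space A p \<Longrightarrow> v \<in> tangent_space A p \<Longrightarrow> g p u v = g p v u"
  unfolding riemannian_metric_def by blast

lemma metric_pos:
  "riemannian_metric A g \<Longrightarrow> u \<in> tangent_space A p \<Longrightarrow> u \<noteq> 0 \<Longrightarrow> g p u u > 0"
  unfolding riemannian_metric_def by blast

lemma metric_scale:
  assumes "riemannian_metric A g" "u \<in> tangent_space A p" "v \<in> tangent_space A p"
  shows "g p (tscale r u) v = r * g p u v" "g p u (tscale r v) = r * g p u v"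
proof -
  have *: "g p (tscale r u) v = r * g p u v" if "u \<in> tangent_space A p" "v \<in> tangent_space A p" for u v
    using assms(1) that unfolding riemannian_metric_def by blast
  then show "g p (tscale r u) v = r * g p u v" using assms by blast
  show "g p u (tscale r v) = r * g p u v"
    using *[OF assms(3,2)] metric_sym[OF assms(1,2) tangent_scale[OF assms(3)], of r] metric_sym[OF assms] by simp
qed

lemma metric_add:
  assumes "riemannian_metric A g" "u \<in> tangent_space A p" "v \<in> tangent_space A p" "w \<in> tangent_space A p"
  shows "g p (u + v) w = g p u w + g p v w" "g p w (u + v) = g p w u + g p w v"
proof -
  show *: "g p (u + v) w = g p u w + g p v w"
    using assms unfolding riemannian_metric_def by blast
  then show "g p w (u + v) = g p w u + g p w v"
    using metric_sym[OF assms(1,4)] assms(2,3) tangent_add[OF assms(2,3)] by simp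
qed

lemma metric_minus:
  assumes "riemannian_metric A g" "u \<in> tangent_space A p" "v \<in> tangent_space A p"
  shows "g p (- u) v = - g p u v" "g p u (- v) = - g p u v"
  using metric_scale[OF assms, of "-1"] by (simp_all add: tscale_minus)

lemma metric_diff:
  assumes "riemannian_metric A g" "u \<in> tangent_space A p" "v \<in> tangent_space A p" "w \<in> tangent_space A p"
  shows "g p (u - v) w = g p u w - g p v w"
  using metric_add(1)[OF assms(1,2) tangent_minus[OF assms(3)] assms(4)] metric_minus(1)[OF assms(1,3,4)] by simp

lemma almost_complex:
  assumes "almost_complex_structure A J" "u \<in> tangent_space A p"
  shows "J p u \<in> tangent_space A p" "v \<in> tangent_space A p \<Longrightarrow> J p (u + v) = J p u + J p v"
    "J p (tscale r u) = tscale r (J p u)" "J p (J p u) = - u"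
  using assms unfolding almost_complex_structure_def by blast+

lemma almost_complex_field [intro]:
  "almost_complex_structure A J \<Longrightarrow> vector_field A X \<Longrightarrow> vector_field A (app_endo J X)"
  unfolding almost_complex_structure_def by blast

lemma hermitian_connection_affine: "hermitian_connection A g J D \<Longrightarrow> affine_connection A D"
  by (simp add: hermitian_connection_def)

lemma hermitian_connection_endo:
  "hermitian_connection A g J D \<Longrightarrow> vector_field A X \<Longrightarrow> vector_field A Y \<Longrightarrow>
    D X (app_endo J Y) = app_endo J (D X Y)"
  unfolding hermitian_connection_def by (elim conjE) simp

lemma hermitian_connection_metric:
  "hermitian_connection A g J D \<Longrightarrow> vector_field A X \<Longrightarrow> vector_field A Y \<Longrightarrow> vector_field A Z \<Longrightarrow>
    dir_deriv X (app_metric g Y Z) = app_metric g (D X Y) Z + app_metric g Y (D X Z)"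
  unfolding hermitian_connection_def by (elim conjE) simp

text \<open>Both g and J are parallel, so the fundamental form is parallel as well. Without torsion
  the brackets in its exterior derivative are differences of covariant derivatives, and everything
  cancels by skewness.\<close>

lemma kaehler_if_torsion_free:
  assumes D: "hermitian_connection A g J D" and g: "riemannian_metric A g"
    and J: "almost_complex_structure A J" and gJ: "compatible A g J"
    and T: "\<And>X Y. vector_field A X \<Longrightarrow> vector_field A Y \<Longrightarrow> torsion A D X Y = 0"
  shows "kaehler A g J"
  unfolding kaehler_def
proof (intro allI impI)
  fix X Y Z assume XYZ: "vector_field A X" "vector_field A Y" "vector_field A Z"
  define \<omega> where "\<omega> = fundamental_form g J"
  have aff: "affine_connection A D" using D by (simp add: hermitian_connection_def)
  note DF = affine_connection_field[OF aff]
  have d\<omega>: "dir_deriv X (app_metric \<omega> Y Z) p = \<omega> p (D X Y p) (Z p) + \<omega> p (Y p) (D X Z p)"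
    if "vector_field A X" "vector_field A Y" "vector_field A Z" for X Y Z p
  proof -
    have "app_metric \<omega> Y Z = app_metric g (app_endo J Y) Z"
      by (simp add: app_metric_def \<omega>_def fundamental_form_def app_endo_def)
    moreover have "dir_deriv X (app_metric g (app_endo J Y) Z)
        = app_metric g (D X (app_endo J Y)) Z + app_metric g (app_endo J Y) (D X Z)"
      by (rule hermitian_connection_metric[OF D that(1) almost_complex_field[OF J that(2)] that(3)])
    moreover have "D X (app_endo J Y) = app_endo J (D X Y)"
      by (rule hermitian_connection_endo[OF D that(1,2)])
    ultimately show ?thesis by (simp add: app_metric_def \<omega>_def fundamental_form_def app_endo_def)
  qed
  have br: "lie_bracket A X Y = D X Y - D Y X" if "vector_field A X" "vector_field A Y" for X Y
    using T[OF that] by (simp add: torsion_def)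
  have skew: "\<omega> p u v = - \<omega> p v u" if "u \<in> tangent_space A p" "v \<in> tangent_space A p" for p u v
  proof -
    have "g p (J p (J p u)) (J p v) = g p (J p u) v"
      using gJ that almost_complex(1)[OF J that(1)] unfolding compatible_def by simp
    then show ?thesis
      using that almost_complex(1,4)[OF J] metric_minus[OF g] metric_sym[OF g]
      by (simp add: \<omega>_def fundamental_form_def)
  qed
  have diff: "\<omega> p (u - v) w = \<omega> p u w - \<omega> p v w"
    if "u \<in> tangent_space A p" "v \<in> tangent_space A p" "w \<in> tangent_space A p" for p u v w
  proof -
    have "J p (- v) = - J p v" using almost_complex(3)[OF J that(2), of "-1"] by (simp add: tscale_minus)
    then have "J p (u - v) = J p u - J p v"
      using almost_complex(2)[OF J that(1) tangent_minus[OF that(2)]] by simp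
    then show ?thesis using that metric_diff[OF g] almost_complex(1)[OF J] by (simp add: \<omega>_def fundamental_form_def)
  qed
  have t: "D P Q p \<in> tangent_space A p" "P p \<in> tangent_space A p"
    if "vector_field A P" "vector_field A Q" for P Q p
    using DF[OF that] that by auto
  show "ext_deriv2 A (fundamental_form g J) X Y Z = 0"
  proof
    fix p
    have app: "app_metric \<omega> P Q p = \<omega> p (P p) (Q p)" for P Q by (simp add: app_metric_def)
    have "ext_deriv2 A \<omega> X Y Z p = 0"
      using XYZ skew[of "Y p" p "D X Z p"] skew[of "X p" p "D Y Z p"] skew[of "X p" p "D Z Y p"]
      by (simp add: ext_deriv2_def d\<omega> br app diff t)
    then show "ext_deriv2 A (fundamental_form g J) X Y Z p = 0 p" by (simp add: \<omega>_def)
  qed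
qed

end

locale hermitian_lie_group = lie_group_manifold A
  for A :: "('a::{topological_group_add, t2_space, second_countable_topology}, 'e::euclidean_space) chart set" +
  fixes g :: "'a metric" and J :: "'a endo"
  assumes metric: "riemannian_metric A g" and metric_left: "left_invariant_metric A g"
    and complex: "complex_structure A J" and complex_left: "left_invariant_endo A J"
    and compat: "compatible A g J"
begin

lemma almost: "almost_complex_structure A J"
  using complex by (simp add: complex_structure_def)

text \<open>The tangent space is a set of operators, not a type. A chart at \<open>0\<close>
  transports metric and complex structure to the Euclidean model, where
  \<open>hermitian_frame\<close> applies.\<close>

lemma unitary_frame:
  assumes "DIM('e) = 4"
  obtains \<iota> :: "complex \<times> complex \<Rightarrow> 'a tangent"
  where "\<And>x y. \<iota> (x + y) = \<iota> x + \<iota> y" "\<And>r x. \<iota> (r *\<^sub>R x) = tscale r (\<iota> x)"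
    "range \<iota> = tangent_space A 0"
    "\<And>x. J 0 (\<iota> x) = \<iota> (cmul \<i> x)" "\<And>x y. g 0 (\<iota> x) (\<iota> y) = Re (herm x y)"
proof -
  obtain U \<phi> where U: "(U, \<phi>) \<in> A" "0 \<in> U" using chart_ex by blast
  define t where "t = tvec U \<phi> 0"
  have t: "t w \<in> tangent_space A 0" "t (v + w) = t v + t w" "t (r *\<^sub>R v) = tscale r (t v)" "t v = t w \<longleftrightarrow> v = w" for v w r
    by (simp_all add: t_def tvec_in_tangent_space[OF U] tvec_linear[OF U] tvec_inject[OF U])
  have rt: "range t = tangent_space A 0" by (simp add: t_def tangent_space_eq[OF U])
  have "\<exists>z. t z = J 0 (t w)" for w
    using almost_complex(1)[OF almost t(1)[of w]] rt by (metis imageE)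
  then obtain J' where J': "\<And>w. t (J' w) = J 0 (t w)" by metis
  have t0: "t 0 = 0" using t(3)[of 0 0] by (simp add: tscale_def zero_fun_def)
  have tm: "t (- w) = - t w" for w using t(3)[of "-1" w] by (simp add: tscale_minus)
  show thesis
  proof (rule hermitian_frame[of "\<lambda>v w. g 0 (t v) (t w)" J'])
    show "DIM('e) = 4" by fact
    show "g 0 (t (x + y)) (t z) = g 0 (t x) (t z) + g 0 (t y) (t z)" for x y z
      by (simp add: t metric_add[OF metric])
    show "g 0 (t (r *\<^sub>R x)) (t y) = r * g 0 (t x) (t y)" for r x y
      by (simp add: t metric_scale[OF metric])
    show "g 0 (t x) (t y) = g 0 (t y) (t x)" for x y by (rule metric_sym[OF metric]) (simp_all add: t)
    show "g 0 (t x) (t x) > 0" if "x \<noteq> 0" for x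
      by (rule metric_pos[OF metric t(1)]) (use that t(4)[of x 0] t0 in simp)
    have "t (J' (x + y)) = t (J' x + J' y)" "t (J' (r *\<^sub>R x)) = t (r *\<^sub>R J' x)" for x y r
      by (simp_all add: t J' almost_complex(2,3)[OF almost t(1)] t(1))
    then show "linear J'" unfolding t(4) by (rule linearI)
    have "t (J' (J' x)) = t (- x)" for x by (simp add: J' tm almost_complex(4)[OF almost t(1)])
    then show "J' (J' x) = - x" for x by (simp add: t(4))
    show "g 0 (t (J' x)) (t (J' y)) = g 0 (t x) (t y)" for x y
      unfolding J' using compat t(1) unfolding compatible_def by simp
  next
    fix f :: "complex \<times> complex \<Rightarrow> 'e"
    assume f: "linear f" "surj f" "\<And>x. f (cmul \<i> x) = J' (f x)" "\<And>x y. g 0 (t (f x)) (t (f y)) = Re (herm x y)"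
    show thesis
    proof (rule that[of "\<lambda>x. t (f x)"])
      show "range (\<lambda>x. t (f x)) = tangent_space A 0"
        unfolding rt[symmetric] using f(2) by (metis image_image)
    qed (simp_all add: linear_add[OF f(1)] linear_cmul[OF f(1)] t f J')
  qed
qed

end

section \<open>Left invariant unitary frames\<close>

locale framed_hermitian_lie_group = hermitian_lie_group A g J
  for A :: "('a::{topological_group_add, t2_space, second_countable_topology}, 'e::euclidean_space) chart set"
    and g :: "'a metric" and J :: "'a endo" +
  fixes \<iota> :: "complex \<times> complex \<Rightarrow> 'a tangent"
  assumes \<iota>_add: "\<iota> (x + y) = \<iota> x + \<iota> y" and \<iota>_scale: "\<iota> (r *\<^sub>R x) = tscale r (\<iota> x)"
    and \<iota>_range: "range \<iota> = tangent_space A 0"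
    and \<iota>_J: "J 0 (\<iota> x) = \<iota> (cmul \<i> x)" and \<iota>_metric: "g 0 (\<iota> x) (\<iota> y) = Re (herm x y)"
begin

definition F :: "complex \<times> complex \<Rightarrow> 'a field" where
  "F x = left_field (\<iota> x)"

lemma F_apply: "F x p = push_left p (\<iota> x)"
  by (simp add: F_def left_field_def)

lemma \<iota>_tangent: "\<iota> x \<in> tangent_space A 0"
  using \<iota>_range by blast

lemma \<iota>_surj: "v \<in> tangent_space A 0 \<Longrightarrow> \<exists>x. v = \<iota> x"
  using \<iota>_range by (metis imageE)

lemma F_field: "vector_field A (F x)"
  unfolding F_def by (rule vector_field_left_field[OF \<iota>_tangent])

lemma F_tangent: "F x p \<in> tangent_space A p"
  by (rule vector_field_tangent[OF F_field])

lemma F_add: "F (x + y) = F x + F y"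
  by (simp add: fun_eq_iff F_apply \<iota>_add push_left_def)

lemma F_scale: "F (r *\<^sub>R x) = fscale (\<lambda>_. r) (F x)"
  by (simp add: fun_eq_iff F_apply \<iota>_scale push_left_def fscale_def tscale_def)

lemma F_minus: "F (- x) = - F x"
  using F_scale[of "-1" x] by (simp add: fscale_minus_one)

lemma F_diff: "F (x - y) = F x - F y"
  using F_add[of x "- y"] by (simp add: F_minus)

lemma F_metric: "g p (F x p) (F y p) = Re (herm x y)"
proof -
  have "g (p + 0) (push_left p (\<iota> x)) (push_left p (\<iota> y)) = g 0 (\<iota> x) (\<iota> y)"
    using metric_left \<iota>_tangent unfolding left_invariant_metric_def by blast
  then show ?thesis by (simp add: F_apply \<iota>_metric)
qed

lemma F_endo: "app_endo J (F x) = F (cmul \<i> x)"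
proof
  fix p
  have "J (p + 0) (push_left p (\<iota> x)) = push_left p (J 0 (\<iota> x))"
    using complex_left \<iota>_tangent unfolding left_invariant_endo_def by blast
  then show "app_endo J (F x) p = F (cmul \<i> x) p" by (simp add: app_endo_def F_apply \<iota>_J)
qed

lemma F_inject: "F x p = F y p \<longleftrightarrow> x = y"
proof
  assume e: "F x p = F y p"
  have "Re (herm (x - y) z) = 0" for z
    using F_metric[of p x z] F_metric[of p y z] e by (simp add: herm_add)
  from Re_herm_nondegenerate[OF this] show "x = y" by simp
qed simp

lemma F_surj:
  assumes "v \<in> tangent_space A p"
  shows "\<exists>x. v = F x p"
proof -
  have "push_left (- p) v \<in> tangent_space A (- p + p)" by (rule push_left_tangent[OF assms])
  then obtain x where x: "push_left (- p) v = \<iota> x" using \<iota>_surj by (metis add.left_inverse)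
  have "push_left p (push_left (- p) v) = v" by (simp add: push_left_assoc push_left_zero)
  then show ?thesis unfolding x by (metis F_apply)
qed

text \<open>The four real frame fields are orthonormal, so the coefficients are inner products with
  them and are smooth because the metric is.\<close>

lemma F_expansion:
  assumes X: "vector_field A X"
  defines "h \<equiv> \<lambda>e. app_metric g X (F e)"
  shows "X = fscale (h (1, 0)) (F (1, 0)) + fscale (h (\<i>, 0)) (F (\<i>, 0))
    + (fscale (h (0, 1)) (F (0, 1)) + fscale (h (0, \<i>)) (F (0, \<i>)))"
proof
  fix p
  obtain x where x: "X p = F x p" using F_surj[OF vector_field_tangent[OF X]] by blast
  have h: "h e p = Re (herm x e)" for e by (simp add: h_def app_metric_def x F_metric)
  have "x = Re (herm x (1, 0)) *\<^sub>R (1, 0) + Re (herm x (\<i>, 0)) *\<^sub>R (\<i>, 0)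
    + (Re (herm x (0, 1)) *\<^sub>R (0, 1) + Re (herm x (0, \<i>)) *\<^sub>R (0, \<i>))"
    by (simp add: herm_def prod_eq_iff complex_eq_iff)
  then have "F x p = F (Re (herm x (1, 0)) *\<^sub>R (1, 0) + Re (herm x (\<i>, 0)) *\<^sub>R (\<i>, 0)
    + (Re (herm x (0, 1)) *\<^sub>R (0, 1) + Re (herm x (0, \<i>)) *\<^sub>R (0, \<i>))) p"
    by simp
  then show "X p = (fscale (h (1, 0)) (F (1, 0)) + fscale (h (\<i>, 0)) (F (\<i>, 0))
    + (fscale (h (0, 1)) (F (0, 1)) + fscale (h (0, \<i>)) (F (0, \<i>)))) p"
    unfolding F_add F_scale x by (simp add: fscale_def h)
qed

lemma smooth_app_metric:
  "vector_field A X \<Longrightarrow> vector_field A Y \<Longrightarrow> smooth_fun_on A UNIV (app_metric g X Y)"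
  using metric unfolding riemannian_metric_def by blast

text \<open>Torsion is linear over functions: the second argument is expanded in the frame, and
  skewness exchanges the arguments to treat the first.\<close>

lemma torsion_zero_on_frame:
  assumes D: "affine_connection A D" and T: "\<And>x y. torsion A D (F x) (F y) = 0"
    and XY: "vector_field A X" "vector_field A Y"
  shows "torsion A D X Y = 0"
proof -
  have ext: "torsion A D X Y = 0" if X: "vector_field A X" and Y: "vector_field A Y" and T: "\<And>y. torsion A D X (F y) = 0" for X Y
  proof -
    let ?h = "\<lambda>e. app_metric g Y (F e)"
    have h: "smooth_fun_on A UNIV (?h e)" for e by (rule smooth_app_metric[OF Y F_field])
    have f: "vector_field A (fscale (?h e) (F e))" for e by (rule vector_field_fscale[OF F_field h])
    have z: "torsion A D X (fscale (?h e) (F e)) = 0" for e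
      unfolding torsion_fscale_right[OF D X F_field h] T by (simp add: fscale_def tscale_def fun_eq_iff)
    show ?thesis
      by (subst F_expansion[OF Y])
        (simp only: torsion_add_right[OF D X vector_field_add[OF f f] vector_field_add[OF f f]]
          torsion_add_right[OF D X f f] z add_0)
  qed
  have "torsion A D X (F y) = 0" for y
    using ext[OF F_field XY(1) T, of y] torsion_commute[of D X "F y"] by simp
  then show ?thesis by (rule ext[OF XY])
qed

section \<open>Structure constants and connection coefficients\<close>

lemma frame_bracket: "\<exists>br. \<forall>x y. lie_bracket A (F x) (F y) = F (br x y)"
proof -
  have "\<exists>z. lie_bracket A (F x) (F y) = F z" for x y
  proof -
    have "lie_bracket A (F x) (F y) 0 \<in> tangent_space A 0"
      by (rule lie_bracket_tangent[OF F_field F_field])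
    then obtain z where "lie_bracket A (F x) (F y) 0 = \<iota> z" using \<iota>_surj by blast
    then show ?thesis
      using left_invariant_eq_left_field[OF left_invariant_lie_bracket[OF left_invariant_left_field left_invariant_left_field]]
      unfolding F_def by metis
  qed
  then show ?thesis by metis
qed

text \<open>A Hermitian connection need not be left invariant, so the coefficients belong to the
  single point \<open>p\<close>.\<close>

lemma connection_coefficients:
  assumes D: "hermitian_connection A g J D"
  shows "\<exists>\<Gamma>. unitary_coeff \<Gamma> \<and> (\<forall>x y. D (F x) (F y) p = F (\<Gamma> x y) p)"
proof -
  note aff = hermitian_connection_affine[OF D]
  have "\<exists>z. D (F x) (F y) p = F z p" for x y
    using F_surj[OF vector_field_tangent[OF affine_connection_field[OF aff F_field F_field]]] .
  then obtain \<Gamma> where \<Gamma>: "\<And>x y. D (F x) (F y) p = F (\<Gamma> x y) p" by metis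
  have c: "smooth_fun_on A UNIV (\<lambda>_. r)" for r by simp
  have dc: "dir_deriv (F x) (\<lambda>_. r) p = 0" for x r
    unfolding dir_deriv_def by (rule tangent_const[OF F_tangent])
  have "F (\<Gamma> (x + y) z) p = F (\<Gamma> x z + \<Gamma> y z) p" "F (\<Gamma> z (x + y)) p = F (\<Gamma> z x + \<Gamma> z y) p" for x y z
    unfolding \<Gamma>[symmetric] F_add affine_connection_add[OF aff F_field F_field F_field] by (simp_all add: \<Gamma>)
  moreover have "F (\<Gamma> (r *\<^sub>R x) y) p = F (r *\<^sub>R \<Gamma> x y) p" "F (\<Gamma> x (r *\<^sub>R y)) p = F (r *\<^sub>R \<Gamma> x y) p" for r x y
    unfolding \<Gamma>[symmetric] F_scale affine_connection_fscale[OF aff F_field F_field c]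
    by (simp_all add: fscale_def \<Gamma> dc) (simp add: tscale_def fun_eq_iff)
  moreover have "F (\<Gamma> x (cmul \<i> y)) p = F (cmul \<i> (\<Gamma> x y)) p" for x y
    unfolding \<Gamma>[symmetric] F_endo[symmetric] hermitian_connection_endo[OF D F_field F_field]
    by (simp add: app_endo_def \<Gamma>)
  moreover have "Re (herm (\<Gamma> x y) z) + Re (herm y (\<Gamma> x z)) = 0" for x y z
  proof -
    have e: "app_metric g (F y) (F z) = (\<lambda>_. Re (herm y z))" by (simp add: app_metric_def F_metric)
    have "app_metric g (D (F x) (F y)) (F z) p + app_metric g (F y) (D (F x) (F z)) p = 0"
      using fun_cong[OF hermitian_connection_metric[OF D F_field F_field F_field, of x y z], of p]
      unfolding e by (simp add: dc)
    then show ?thesis by (simp add: app_metric_def \<Gamma> F_metric)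
  qed
  ultimately have "unitary_coeff \<Gamma>" unfolding F_inject unitary_coeff_def by blast
  then show ?thesis using \<Gamma> by blast
qed

lemma frame_torsion:
  assumes "lie_bracket A (F x) (F y) = F (br x y)"
    "D (F x) (F y) p = F (\<Gamma> x y) p" "D (F y) (F x) p = F (\<Gamma> y x) p"
  shows "torsion A D (F x) (F y) p = F (\<Gamma> x y - \<Gamma> y x - br x y) p"
  by (simp add: torsion_def assms F_diff)

text \<open>The pair is the usual (1,0)-part \<open>X - \<i> J X\<close>, up to a factor 2, of
  \<open>X = F x\<close>.\<close>

lemma type_10_frame: "type_10 A J (F x, F (- cmul \<i> x))"
  unfolding type_10_def
  by (simp add: F_field F_endo F_minus[symmetric] cmul_simps)

lemma chern_frame:
  assumes D: "chern_connection A g J D"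
    and br: "\<And>x y. lie_bracket A (F x) (F y) = F (br x y)"
    and \<Gamma>: "\<And>x y. D (F x) (F y) p = F (\<Gamma> x y) p"
  shows "(\<Gamma> x y - \<Gamma> y x - br x y)
    + (\<Gamma> (cmul \<i> x) (cmul \<i> y) - \<Gamma> (cmul \<i> y) (cmul \<i> x) - br (cmul \<i> x) (cmul \<i> y)) = 0"
proof -
  let ?T = "\<lambda>x y. \<Gamma> x y - \<Gamma> y x - br x y"
  note T = frame_torsion[where D = D and br = br and \<Gamma> = \<Gamma>, OF br \<Gamma> \<Gamma>]
  have aff: "affine_connection A D"
    using D hermitian_connection_affine unfolding chern_connection_def by blast
  have one: "smooth_fun_on A UNIV (\<lambda>_. - 1)" by simp
  have minus: "torsion A D (F (- u)) (F v) = - torsion A D (F u) (F v)" for u v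
  proof -
    have "torsion A D (F v) (F (- u)) = - torsion A D (F v) (F u)"
      using torsion_fscale_right[OF aff F_field F_field one, of v u] by (simp add: fscale_minus_one F_minus)
    then show ?thesis
      using torsion_commute[of D "F (- u)" "F v"] torsion_commute[of D "F u" "F v"] by simp
  qed
  \<comment> \<open>Its first component, the real part, is the torsion on \<open>x\<close>,
    \<open>y\<close> plus the torsion on \<open>cmul \<i> x\<close>,
    \<open>cmul \<i> y\<close>.\<close>
  have "torsion_complex A D (F x, F (- cmul \<i> x)) (conj_field (F y, F (- cmul \<i> y))) = (0, 0)"
    using D type_10_frame unfolding chern_connection_def by blast
  then have "torsion A D (F x) (F y) + torsion A D (F (cmul \<i> x)) (F (cmul \<i> y)) = 0"
    by (simp add: torsion_complex_def conj_field_def minus flip: F_minus)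
  from fun_cong[OF this, of p]
  have "F (?T x y + ?T (cmul \<i> x) (cmul \<i> y)) p = F 0 p"
    using F_scale[of 0 0] unfolding F_add by (simp add: T fscale_def tscale_def fun_eq_iff)
  then show ?thesis unfolding F_inject .
qed

lemma bismut_frame:
  assumes D: "bismut_connection A g J D"
    and br: "\<And>x y. lie_bracket A (F x) (F y) = F (br x y)"
    and \<Gamma>: "\<And>x y. D (F x) (F y) p = F (\<Gamma> x y) p"
  shows "Re (herm (\<Gamma> x y - \<Gamma> y x - br x y) z) = - Re (herm (\<Gamma> x z - \<Gamma> z x - br x z) y)"
proof -
  note T = frame_torsion[where D = D and br = br and \<Gamma> = \<Gamma>, OF br \<Gamma> \<Gamma>]
  have "app_metric g (torsion A D (F x) (F y)) (F z) = - app_metric g (torsion A D (F x) (F z)) (F y)"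
    using D F_field unfolding bismut_connection_def by blast
  from fun_cong[OF this, of p] show ?thesis by (simp add: app_metric_def T F_metric)
qed

text \<open>The structure constants do not depend on the point, so they cancel when the Chern
  conditions at \<open>p\<close> and at \<open>0\<close> are subtracted. The difference of the
  coefficients then satisfies the homogeneous conditions and is zero.\<close>

lemma chern_coefficients:
  assumes D: "chern_connection A g J D"
    and br: "\<And>x y. lie_bracket A (F x) (F y) = F (br x y)"
  shows "\<exists>\<Gamma>. unitary_coeff \<Gamma> \<and> (\<forall>x y. D (F x) (F y) = F (\<Gamma> x y))"
proof -
  have "\<exists>\<Gamma>. unitary_coeff \<Gamma> \<and> (\<forall>x y. D (F x) (F y) p = F (\<Gamma> x y) p)" for p
    using D by (intro connection_coefficients) (simp add: chern_connection_def)
  then obtain \<Gamma> where u: "\<And>p. unitary_coeff (\<Gamma> p)" and \<Gamma>: "\<And>p x y. D (F x) (F y) p = F (\<Gamma> p x y) p"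
    by metis
  note uD = unitary_coeffD[OF u]
  have "\<Gamma> p x y - \<Gamma> 0 x y = 0" for p x y
  proof (rule chern_difference_zero[of "\<lambda>x y. \<Gamma> p x y - \<Gamma> 0 x y"])
    show "Re (herm (\<Gamma> p x y - \<Gamma> 0 x y) z) + Re (herm y (\<Gamma> p x z - \<Gamma> 0 x z)) = 0" for x y z
      using uD(6)[of p x y z] uD(6)[of 0 x y z] by (simp add: herm_add)
    show "\<Gamma> p x y - \<Gamma> 0 x y - (\<Gamma> p y x - \<Gamma> 0 y x) + (\<Gamma> p (cmul \<i> x) (cmul \<i> y) - \<Gamma> 0 (cmul \<i> x) (cmul \<i> y)
      - (\<Gamma> p (cmul \<i> y) (cmul \<i> x) - \<Gamma> 0 (cmul \<i> y) (cmul \<i> x))) = 0" (is "?l = 0") for x y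
    proof -
      let ?c = "\<lambda>p. (\<Gamma> p x y - \<Gamma> p y x - br x y)
        + (\<Gamma> p (cmul \<i> x) (cmul \<i> y) - \<Gamma> p (cmul \<i> y) (cmul \<i> x) - br (cmul \<i> x) (cmul \<i> y))"
      have "?l = ?c p - ?c 0" by simp
      also have "\<dots> = 0" unfolding chern_frame[OF D br \<Gamma>] by simp
      finally show ?thesis .
    qed
  qed (simp_all add: uD(5,7) cmul_simps)
  then have "D (F x) (F y) = F (\<Gamma> 0 x y)" for x y by (intro ext) (metis \<Gamma> eq_iff_diff_eq_0)
  then show ?thesis using u by blast
qed

text \<open>The same argument as for the Chern connection, with skew-symmetry of the torsion as the
  linear condition.\<close>

lemma bismut_coefficients:
  assumes D: "bismut_connection A g J D"
    and br: "\<And>x y. lie_bracket A (F x) (F y) = F (br x y)"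
  shows "\<exists>\<Gamma>. unitary_coeff \<Gamma> \<and> (\<forall>x y. D (F x) (F y) = F (\<Gamma> x y))"
proof -
  have "\<exists>\<Gamma>. unitary_coeff \<Gamma> \<and> (\<forall>x y. D (F x) (F y) p = F (\<Gamma> x y) p)" for p
    using D by (intro connection_coefficients) (simp add: bismut_connection_def)
  then obtain \<Gamma> where u: "\<And>p. unitary_coeff (\<Gamma> p)" and \<Gamma>: "\<And>p x y. D (F x) (F y) p = F (\<Gamma> p x y) p"
    by metis
  note uD = unitary_coeffD[OF u]
  have "\<Gamma> p x y - \<Gamma> 0 x y = 0" for p x y
  proof (rule bismut_difference_zero[of "\<lambda>x y. \<Gamma> p x y - \<Gamma> 0 x y"])
    show "Re (herm (\<Gamma> p x y - \<Gamma> 0 x y) z) + Re (herm y (\<Gamma> p x z - \<Gamma> 0 x z)) = 0" for x y z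
      using uD(6)[of p x y z] uD(6)[of 0 x y z] by (simp add: herm_add)
    show "Re (herm (\<Gamma> p x y - \<Gamma> 0 x y - (\<Gamma> p y x - \<Gamma> 0 y x)) z)
      = - Re (herm (\<Gamma> p x z - \<Gamma> 0 x z - (\<Gamma> p z x - \<Gamma> 0 z x)) y)" for x y z
      using bismut_frame[OF D br \<Gamma>, of p x y z] bismut_frame[OF D br \<Gamma>, of 0 x y z] by (simp add: herm_add)
  qed (simp add: uD(5) cmul_simps)
  then have "D (F x) (F y) = F (\<Gamma> 0 x y)" for x y by (intro ext) (metis \<Gamma> eq_iff_diff_eq_0)
  then show ?thesis using u by blast
qed

lemma F_inject_field: "F x = F y \<longleftrightarrow> x = y"
  using F_inject by metis

lemma F_zero: "F 0 = 0"
  using F_diff[of 0 0] by simp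

theorem flat_gauduchon_imp_kaehler:
  assumes Dc: "chern_connection A g J Dc" and Db: "bismut_connection A g J Db"
    and s: "s \<noteq> 0" "s \<noteq> 2" and flat: "flat_connection A (gauduchon s Dc Db)"
  shows "kaehler A g J"
proof -
  obtain br where br: "\<And>x y. lie_bracket A (F x) (F y) = F (br x y)" using frame_bracket by blast
  obtain C where C: "unitary_coeff C" "\<And>x y. Dc (F x) (F y) = F (C x y)"
    using chern_coefficients[OF Dc br] by blast
  obtain B where B: "unitary_coeff B" "\<And>x y. Db (F x) (F y) = F (B x y)"
    using bismut_coefficients[OF Db br] by blast
  define D where "D x y = (1 - s / 2) *\<^sub>R C x y + (s / 2) *\<^sub>R B x y" for x y
  have D: "gauduchon s Dc Db (F x) (F y) = F (D x y)" for x y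
    by (simp add: gauduchon_def C B D_def F_add F_scale)
  have br_alt: "br x y = - br y x" for x y
    using lie_bracket_commute[of "F x" "F y"] by (simp add: br F_inject_field flip: F_minus)
  have br_add: "br z (x + y) = br z x + br z y" for x y z
    using lie_bracket_add_right[OF F_field F_field F_field, of z x y] by (simp add: br F_inject_field flip: F_add)
  have br_scale: "br y (r *\<^sub>R x) = r *\<^sub>R br y x" for r x y
  proof -
    have c: "smooth_fun_on A UNIV (\<lambda>_. r)" by simp
    have "dir_deriv (F y) (\<lambda>_. r) = (\<lambda>_. 0)" by (simp add: dir_deriv_def fun_eq_iff tangent_const[OF F_tangent])
    then have "lie_bracket A (F y) (F (r *\<^sub>R x)) = fscale (\<lambda>_. 0) (F x) + F (r *\<^sub>R br y x)"
      unfolding F_scale lie_bracket_fscale_right[OF F_field F_field c] br by simp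
    also have "\<dots> = F (r *\<^sub>R br y x)" by (simp add: fscale_def tscale_def fun_eq_iff)
    finally show ?thesis by (simp add: br F_inject_field)
  qed
  have "br x y = C x y - C y x" for x y
  proof (rule flat_gauduchon_imp_chern_torsion_zero[OF C(1) B(1) _ _ br_alt _ _ _ _ _ D_def s])
    show "br (x + y) z = br x z + br y z" for x y z
      unfolding br_alt[of _ z] br_add by simp
    show "br (r *\<^sub>R x) y = r *\<^sub>R br x y" for r x y
      unfolding br_alt[of _ y] br_scale by simp
    show "br x (br y z) + br y (br z x) + br z (br x y) = 0" for x y z
      using lie_bracket_jacobi[OF F_field F_field F_field, of x y z]
      by (simp add: br F_inject_field flip: F_add F_zero)
    show "D (br x y) z = D x (D y z) - D y (D x z)" for x y z
    proof -
      have "curvature A (gauduchon s Dc Db) (F x) (F y) (F z) = 0"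
        using flat F_field unfolding flat_connection_def by blast
      then have "D x (D y z) - D y (D x z) - D (br x y) z = 0"
        by (simp add: curvature_def D br F_inject_field flip: F_diff F_zero)
      then show ?thesis by simp
    qed
    show "br x y + cmul \<i> (br (cmul \<i> x) y) + cmul \<i> (br x (cmul \<i> y)) - br (cmul \<i> x) (cmul \<i> y) = 0" for x y
    proof -
      have "nijenhuis A J (F x) (F y) = 0"
        using complex F_field unfolding complex_structure_def by blast
      then show ?thesis
        by (simp add: nijenhuis_def F_endo br F_inject_field flip: F_diff F_zero F_add)
    qed
    show "(C x y - C y x - br x y) + (C (cmul \<i> x) (cmul \<i> y) - C (cmul \<i> y) (cmul \<i> x) - br (cmul \<i> x) (cmul \<i> y)) = 0" for x y
      by (rule chern_frame[OF Dc br, of 0]) (simp add: C)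
    show "Re (herm (B x y - B y x - br x y) z) = - Re (herm (B x z - B z x - br x z) y)" for x y z
      by (rule bismut_frame[OF Db br, of 0]) (simp add: B)
  qed
  then have T: "torsion A Dc (F x) (F y) = 0" for x y
    by (simp add: torsion_def C br flip: F_diff F_zero)
  have herm: "hermitian_connection A g J Dc" using Dc by (simp add: chern_connection_def)
  show ?thesis
    by (rule kaehler_if_torsion_free[OF herm metric almost compat])
      (rule torsion_zero_on_frame[OF hermitian_connection_affine[OF herm] T])
qed

end

theorem theorem1p2:
  fixes A :: "('a::{topological_group_add, t2_space, second_countable_topology}, real ^ 4) chart set"
    and g :: "'a metric" and J :: "'a endo" and Dc Db :: "'a connection" and s :: real
  assumes "lie_group A"
    and "connected (UNIV :: 'a set)"
    and "riemannian_metric A g" and "left_invariant_metric A g"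
    and "complex_structure A J" and "left_invariant_endo A J"
    and "compatible A g J"
    and "chern_connection A g J Dc"
    and "bismut_connection A g J Db"
    and "s \<noteq> 0" and "s \<noteq> 2"
    and "flat_connection A (gauduchon s Dc Db)"
  shows "kaehler A g J"
proof -
  interpret hermitian_lie_group A g J
    by unfold_locales (fact assms)+
  have "DIM(real ^ 4) = 4" by simp
  then obtain \<iota> where "\<And>x y. \<iota> (x + y) = \<iota> x + \<iota> y" "\<And>r x. \<iota> (r *\<^sub>R x) = tscale r (\<iota> x)"
    "range \<iota> = tangent_space A 0" "\<And>x. J 0 (\<iota> x) = \<iota> (cmul \<i> x)" "\<And>x y. g 0 (\<iota> x) (\<iota> y) = Re (herm x y)"
    using unitary_frame by blast
  then interpret framed_hermitian_lie_group A g J \<iota>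
    by unfold_locales
  show ?thesis by (rule flat_gauduchon_imp_kaehler) (fact assms)+
qed

end
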